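(* Let $G=(\mathbb{V},\mathbb{E})$ be a quasi-transitive graph and let $\Gamma\le \mathrm{Aut}(G)$ be a subgroup whose action on $G$ has finitely many orbits (on $\mathbb{V}$). Then the following two statements hold. (A) Let $f:\mathbb{R}\to\mathbb{R}$ be continuous with $|f(u)|\le a(|u|+|u|^{q-1})$ for all $u$, for some $a>0$ and $q>2$, and put $F(u)=\int_0^uf(s)\,ds$. Assume: $f(u)=o(u)$ as $u\to0$; $u\mapsto\frac{f(u)}{|u|}$ is strictly increasing on $(-\infty,0)$ and strictly increasing on $(0,+\infty)$; and $\frac{F(u)}{u^2}\to\infty$ as $|u|\to\infty$. Assume moreover that $V:\mathbb{V}\to\mathbb{R}$ satisfies, for some constants $V_0,V_\infty$, $0<V_0\le\inf_{\mathbb{V}}V\le\sup_{\mathbb{V}}V=V_\infty<\infty$ and $V(x)\to V_\infty$ as $x\to\infty$ in $G$. Then the equation $-\Delta u+V(x)u=f(u)$ on $\mathbb{V}$, $u\in H^1(\mathbb{V})$, has a ground state solution. (B) Let $f:\mathbb{V}\times\mathbb{R}\to\mathbb{R}$ be continuous in $u$ with $|f(x,u)|\le a(|u|+|u|^{q-1})$ for all $x\in\mathbb{V}$, $u\in\mathbb{R}$, for some $a>0$ and $q>2$, and put $F(x,u)=\int_0^uf(x,s)\,ds$. Assume: (i) $V:\mathbb{V}\to\mathbb{R}$ and $f$ are $\Gamma$-invariant, i.e. $V(gx)=V(x)$ and $f(gx,u)=f(x,u)$ for all $g\in\Gamma$, $x\in\mathbb{V}$, $u\in\mathbb{R}$,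 and $V(x)>0$ for all $x\in\mathbb{V}$; (ii) $f(x,u)=o(u)$ uniformly in $x$ as $u\to0$; (iii) for each $x$, $u\mapsto\frac{f(x,u)}{|u|}$ is strictly increasing on $(-\infty,0)$ and strictly increasing on $(0,+\infty)$; (iv) $\frac{F(x,u)}{u^2}\to\infty$ uniformly in $x$ as $|u|\to\infty$. Then the equation $-\Delta u+V(x)u=f(x,u)$ on $\mathbb{V}$, $u\in H^1(\mathbb{V})$, has a ground state solution.
   Context: Graphs $G=(\mathbb{V},\mathbb{E})$ are simple, undirected and locally finite (each vertex has finitely many neighbours); $x\sim y$ means $\{x,y\}\in\mathbb{E}$. $\mathrm{Aut}(G)$ is the group of automorphisms of $G$; $G$ is quasi-transitive if the action of $\mathrm{Aut}(G)$ on $G$ has finitely many orbits. "$V(x)\to V_\infty$ as $x\to\infty$ in $G$" means: for every $\varepsilon>0$ the set $\{x\in\mathbb{V}:|V(x)-V_\infty|\ge\varepsilon\}$ is finite (for connected $G$ this is the same as $V(x)\to V_\infty$ as the combinatorial distance $d(x,x_0)\to\infty$ for a fixed vertex $x_0$). The Laplacian is $\Delta u(x)=\sum_{y\sim x}(u(y)-u(x))$. $H^1(\mathbb{V})$ is the completion of the finitely supported functions $C_c(\mathbb{V})$ under $\|u\|_{H^1}=\big(\frac12\sum_{x}\sum_{y\sim x}(u(y)-u(x))^2+\sum_x u(x)^2\big)^{1/2}$ (a quasi-transitive graph has bounded degree, so this norm is equivalent to the $\ell^2$ norm and $H^1(\mathbb{V})=\ell^2(\mathbb{V})$ as a set). The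 energy functional on $H^1(\mathbb{V})$ is $$\Phi(u)=\frac12\sum_{x\in\mathbb{V}}\Big(\frac12\sum_{y\sim x}(u(y)-u(x))^2+V(x)u(x)^2\Big)-\sum_{x\in\mathbb{V}}F(x,u(x)),$$ with $F(x,u)=F(u)$ in (A). A ground state solution is a solution $u\in H^1(\mathbb{V})$ of the equation corresponding to the least positive critical value of $\Phi$, i.e. $\Phi'(u)=0$, $\Phi(u)>0$, and $\Phi(u)\le\Phi(v)$ for every $v\in H^1(\mathbb{V})$ with $\Phi'(v)=0$ and $\Phi(v)>0$. *)

theory Defs
  imports "HOL-Analysis.Analysis" "HOL-Algebra.Group_Action"
begin

text \<open>A graph is given by its adjacency relation on the type of vertices.  The sums over
  neighbours below are meant for locally finite graphs.\<close>

definition aut_group :: "('v \<Rightarrow> 'v \<Rightarrow> bool) \<Rightarrow> ('v \<Rightarrow> 'v) monoid" where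
  "aut_group adj =
     \<lparr>carrier = {g. bij g \<and> (\<forall>x y. adj (g x) (g y) \<longleftrightarrow> adj x y)}, mult = (\<circ>), one = id\<rparr>"

definition finitely_many_orbits :: "('v \<Rightarrow> 'v) monoid \<Rightarrow> bool" where
  "finitely_many_orbits G \<longleftrightarrow> finite (orbits G UNIV (\<lambda>g. g))"

definition quasi_transitive :: "('v \<Rightarrow> 'v \<Rightarrow> bool) \<Rightarrow> bool" where
  "quasi_transitive adj \<longleftrightarrow> finitely_many_orbits (aut_group adj)"

definition laplacian :: "('v \<Rightarrow> 'v \<Rightarrow> bool) \<Rightarrow> ('v \<Rightarrow> real) \<Rightarrow> 'v \<Rightarrow> real" where
  "laplacian adj u x = (\<Sum>y\<in>{y. adj x y}. u y - u x)"

definition grad_sq :: "('v \<Rightarrow> 'v \<Rightarrow> bool) \<Rightarrow> ('v \<Rightarrow> real) \<Rightarrow> 'v \<Rightarrow> real" where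
  "grad_sq adj u x = (\<Sum>y\<in>{y. adj x y}. (u y - u x)\<^sup>2)"

definition H1_norm :: "('v \<Rightarrow> 'v \<Rightarrow> bool) \<Rightarrow> ('v \<Rightarrow> real) \<Rightarrow> real" where
  "H1_norm adj u = sqrt (1/2 * (\<Sum>\<^sub>\<infinity>x. grad_sq adj u x) + (\<Sum>\<^sub>\<infinity>x. (u x)\<^sup>2))"

text \<open>The completion of the finitely supported functions, realised as a space of functions:
  since the norm dominates point values and the functions of finite norm form a complete space,
  the completion is the closure of the finitely supported functions in that space.  Finiteness of
  the norm has to be required explicitly, because \<^const>\<open>infsum\<close> is zero on non-summable
  families.\<close>

definition H1 :: "('v \<Rightarrow> 'v \<Rightarrow> bool) \<Rightarrow> ('v \<Rightarrow> real) set" where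
  "H1 adj = {u. grad_sq adj u summable_on UNIV \<and> (\<lambda>x. (u x)\<^sup>2) summable_on UNIV \<and>
     (\<exists>\<phi> :: nat \<Rightarrow> 'v \<Rightarrow> real. (\<forall>n. finite {x. \<phi> n x \<noteq> 0}) \<and>
        (\<lambda>n. H1_norm adj (\<lambda>x. \<phi> n x - u x)) \<longlonglongrightarrow> 0)}"

text \<open>The interval integral is oriented, so for negative \<open>u\<close> this is minus the integral
  over \<open>[u, 0]\<close>.\<close>

definition primitive :: "(real \<Rightarrow> real) \<Rightarrow> real \<Rightarrow> real" where
  "primitive f u = (LBINT s=ereal 0..ereal u. f s)"

definition energy ::
  "('v \<Rightarrow> 'v \<Rightarrow> bool) \<Rightarrow> ('v \<Rightarrow> real) \<Rightarrow> ('v \<Rightarrow> real \<Rightarrow> real) \<Rightarrow> ('v \<Rightarrow> real) \<Rightarrow> real" where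
  "energy adj V f u =
     1/2 * (\<Sum>\<^sub>\<infinity>x. 1/2 * grad_sq adj u x + V x * (u x)\<^sup>2) - (\<Sum>\<^sub>\<infinity>x. primitive (f x) (u x))"

text \<open>\<open>L\<close> is the Frechet derivative at \<open>u\<close> of a functional on \<^const>\<open>H1\<close>.  Only its values
  on \<^const>\<open>H1\<close> matter.\<close>

definition has_H1_derivative ::
  "('v \<Rightarrow> 'v \<Rightarrow> bool) \<Rightarrow> (('v \<Rightarrow> real) \<Rightarrow> real) \<Rightarrow> (('v \<Rightarrow> real) \<Rightarrow> real) \<Rightarrow> ('v \<Rightarrow> real) \<Rightarrow> bool" where
  "has_H1_derivative adj \<Phi> L u \<longleftrightarrow>
     (\<forall>v\<in>H1 adj. \<forall>w\<in>H1 adj. L (\<lambda>x. v x + w x) = L v + L w) \<and>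
     (\<forall>c. \<forall>v\<in>H1 adj. L (\<lambda>x. c * v x) = c * L v) \<and>
     (\<exists>K. \<forall>v\<in>H1 adj. \<bar>L v\<bar> \<le> K * H1_norm adj v) \<and>
     (\<forall>\<epsilon>>0. \<exists>\<delta>>0. \<forall>h\<in>H1 adj. H1_norm adj h < \<delta> \<longrightarrow>
        \<bar>\<Phi> (\<lambda>x. u x + h x) - \<Phi> u - L h\<bar> \<le> \<epsilon> * H1_norm adj h)"

definition critical_point ::
  "('v \<Rightarrow> 'v \<Rightarrow> bool) \<Rightarrow> (('v \<Rightarrow> real) \<Rightarrow> real) \<Rightarrow> ('v \<Rightarrow> real) \<Rightarrow> bool" where
  "critical_point adj \<Phi> u \<longleftrightarrow> u \<in> H1 adj \<and> has_H1_derivative adj \<Phi> (\<lambda>_. 0) u"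

definition solution ::
  "('v \<Rightarrow> 'v \<Rightarrow> bool) \<Rightarrow> ('v \<Rightarrow> real) \<Rightarrow> ('v \<Rightarrow> real \<Rightarrow> real) \<Rightarrow> ('v \<Rightarrow> real) \<Rightarrow> bool" where
  "solution adj V f u \<longleftrightarrow> u \<in> H1 adj \<and> (\<forall>x. - laplacian adj u x + V x * u x = f x (u x))"

definition ground_state ::
  "('v \<Rightarrow> 'v \<Rightarrow> bool) \<Rightarrow> ('v \<Rightarrow> real) \<Rightarrow> ('v \<Rightarrow> real \<Rightarrow> real) \<Rightarrow> ('v \<Rightarrow> real) \<Rightarrow> bool" where
  "ground_state adj V f u \<longleftrightarrow>
     solution adj V f u \<and> critical_point adj (energy adj V f) u \<and> energy adj V f u > 0 \<and>
     (\<forall>v. critical_point adj (energy adj V f) v \<and> energy adj V f v > 0 \<longrightarrow>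
        energy adj V f u \<le> energy adj V f v)"

end

theory Submission
  imports Defs "HOL-Complex_Analysis.Great_Picard"
begin

text \<open>On a graph of bounded degree \<^term>\<open>H1 adj\<close> is exactly \<open>\<ell>\<^sup>2\<close>, and the energy is
\<open>\<Phi> u = Q u / 2 - \<Sum>F(x, u x)\<close> with \<open>Q\<close> the quadratic form of \<open>L = -\<Delta> + V\<close>.  Every critical point
\<open>u \<noteq> 0\<close> satisfies \<open>J u = \<Phi>'(u) u = Q u - \<Sum>f(x, u x) u x = 0\<close>, that is, it lies on the Nehari
set \<open>N\<close>.  A minimizer of \<open>\<Phi>\<close> on \<open>N\<close> that is itself critical is therefore a ground state, and two
things have to be shown: minimizers are critical, and a minimizer exists.

Monotonicity of \<open>f(x, s) / \<bar>s\<bar>\<close> governs both.  It makes \<open>t \<mapsto> \<Phi> (t u)\<close> maximal at \<open>t = 1\<close> when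
\<open>u \<in> N\<close> (\<open>ray_max\<close>), and makes \<open>\<Psi> u = \<Sum>(f(x, u x) u x / 2 - F(x, u x))\<close>, which equals
\<open>\<Phi> - J / 2\<close>, nondecreasing along rays.  Consequently a nonzero \<open>w\<close> with \<open>J w \<le> 0\<close> can be shrunk to
a point of \<open>N\<close> with energy at most \<open>\<Psi> w\<close> (\<open>\<Psi>_lower\<close>).

\<^bold>\<open>Minimizers are critical\<close> (\<open>minimizer_solves\<close>).  As \<open>f\<close> is only continuous, \<open>N\<close> need not be a
\<open>C\<^sup>1\<close> manifold, so the argument perturbs at single vertices.  If the equation failed at a vertex \<open>x\<close>, adding
a small multiple of the indicator of \<open>x\<close> would strictly lower \<open>\<Phi> (t u)\<close> for all \<open>t\<close> near \<open>1\<close>, and the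
perturbed ray still meets \<open>N\<close> for such a \<open>t\<close> by the intermediate value theorem.

\<^bold>\<open>Compactness\<close> (\<open>attained\<close>).  A minimizing sequence \<open>u\<^sub>n\<close> in \<open>N\<close> is bounded in \<open>\<ell>\<^sup>2\<close>, so a subsequence
converges pointwise to some \<open>v \<in> \<ell>\<^sup>2\<close>.  Suppose \<open>v \<noteq> 0\<close>.  If \<open>J v \<le> 0\<close>, then \<open>v\<close> shrinks to a point of
\<open>N\<close> of energy at most \<open>\<Psi> v\<close>, which Fatou bounds by the infimum.  If \<open>J v > 0\<close>, then the part of
\<open>u\<^sub>n\<close> outside a large finite set eventually has \<open>J < 0\<close>, while its \<open>\<Psi>\<close> is smaller than the infimum
by a fixed amount, which is impossible.  Cutting off at a finite set splits the nonlinear sums exactly,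
and the cross terms of \<open>Q\<close> are finite sums, hence continuous under pointwise convergence.

\<^bold>\<open>Nonzero limits.\<close>  Elements of \<open>N\<close> have sup norm bounded below (\<open>nonvanishing\<close>).  In the
invariant case, elements of \<open>\<Gamma>\<close> move a vertex where \<open>u\<^sub>n\<close> is large into a finite set of orbit
representatives (\<open>minimizer_invariant\<close>).  In the case \<open>V \<rightarrow> V\<^sub>\<infinity>\<close> no translation is made: let \<open>w\<close> be a
minimizer for the constant potential \<open>V\<^sub>\<infinity>\<close>, which the invariant case provides.  If the limit \<open>v\<close>
vanishes, then \<open>u\<^sub>n\<close> does not feel the difference \<open>V\<^sub>\<infinity> - V\<close>, so the level of \<open>w\<close> is at most the
infimum for \<open>V\<close>; as \<open>V \<le> V\<^sub>\<infinity>\<close>, shrinking \<open>w\<close> onto the Nehari set of \<open>V\<close> gives a minimizer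
(\<open>minimizer_below_infinity\<close>).\<close>

section \<open>Nonlinearities with increasing quotient\<close>

lemma primitive_deriv:
  assumes "continuous_on UNIV g"
  shows "(primitive g has_real_derivative g s) (at s)"
proof -
  define a b where "a = min 0 s - 1" and "b = max 0 s + 1"
  have ab: "a < s" "s < b" "a \<le> 0" "0 \<le> b"
    by (auto simp: a_def b_def)
  have "((\<lambda>u. LBINT y=ereal 0..ereal u. g y) has_vector_derivative g s) (at s within {a..b})"
    by (rule interval_integral_FTC2) (use ab assms continuous_on_subset in auto)
  then have "((\<lambda>u. LBINT y=ereal 0..ereal u. g y) has_vector_derivative g s) (at s)"
    using ab at_within_Icc_at by metis
  moreover have "primitive g = (\<lambda>u. LBINT y=ereal 0..ereal u. g y)"
    by (simp add: primitive_def fun_eq_iff)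
  ultimately show ?thesis
    by (simp add: has_real_derivative_iff_has_vector_derivative)
qed

lemma primitive_0 [simp]: "primitive g 0 = 0"
  by (simp add: primitive_def)

text \<open>Growth of the nonlinearity enters the proof only through linear bounds on bounded ranges of \<open>s\<close>, because
square-summable functions are bounded.  The condition \<open>ratio\<close> treats both half-lines at once:
\<open>f x s / s\<close> increases with \<open>\<bar>s\<bar>\<close> as long as the sign is kept.\<close>

locale nonlinearity =
  fixes f :: "'v \<Rightarrow> real \<Rightarrow> real"
  assumes cont: "\<And>x. continuous_on UNIV (f x)"
    and growth: "\<And>M. \<exists>K\<ge>0. \<forall>x s. \<bar>s\<bar> \<le> M \<longrightarrow> \<bar>f x s\<bar> \<le> K * \<bar>s\<bar>"
    and small: "\<And>e. e > 0 \<Longrightarrow> \<exists>d>0. \<forall>x s. \<bar>s\<bar> < d \<longrightarrow> \<bar>f x s\<bar> \<le> e * \<bar>s\<bar>"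
    and ratio: "\<And>x s t. s * t > 0 \<Longrightarrow> \<bar>s\<bar> < \<bar>t\<bar> \<Longrightarrow> f x s / s < f x t / t"
    and superquadratic: "\<And>C. \<exists>R>0. \<forall>x s. \<bar>s\<bar> \<ge> R \<longrightarrow> primitive (f x) s \<ge> C * s\<^sup>2"
begin

abbreviation F where "F x \<equiv> primitive (f x)"

text \<open>The density of \<open>\<Phi> u - \<Phi>'(u) u / 2\<close>; the quadratic part of the energy cancels in this combination.\<close>

definition H where "H x s = f x s * s / 2 - F x s"

lemma f_0 [simp]: "f x 0 = 0"
  using growth[of 0] by auto

lemma F_deriv: "(F x has_real_derivative f x s) (at s)"
  using primitive_deriv cont by blast

text \<open>The quotient decreases to its limit \<open>0\<close> as \<open>s\<close> shrinks to \<open>0\<close> along the ray.\<close>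

lemma ratio_nonneg: "f x s / s \<ge> 0"
proof (cases "s = 0")
  case False
  show ?thesis
  proof (rule field_le_epsilon)
    fix e :: real assume "e > 0"
    then obtain d where d: "d > 0" "\<And>x s. \<bar>s\<bar> < d \<Longrightarrow> \<bar>f x s\<bar> \<le> e * \<bar>s\<bar>"
      using small by blast
    \<comment> \<open>a factor below \<open>1\<close> that brings \<open>s\<close> into the range where \<open>f\<close> is at most \<open>e * \<bar>s\<bar>\<close>\<close>
    define c where "c = min (1/2) (d / (2 * \<bar>s\<bar>))"
    have c: "c > 0" "c < 1" "c * \<bar>s\<bar> < d"
      using d(1) False by (auto simp: c_def min_def field_simps)
    have "f x (c * s) / (c * s) < f x s / s"
      by (rule ratio) (use c False in \<open>auto simp: abs_mult zero_less_mult_iff mult_less_0_iff\<close>)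
    moreover have "\<bar>f x (c * s)\<bar> \<le> e * \<bar>c * s\<bar>"
      by (rule d) (use c in \<open>auto simp: abs_mult\<close>)
    then have "\<bar>f x (c * s) / (c * s)\<bar> \<le> e"
      using False c by (simp add: abs_divide divide_le_eq)
    ultimately show "0 \<le> f x s / s + e" by linarith
  qed
qed auto

lemma f_mult_nonneg: "f x s * s \<ge> 0"
proof -
  have "f x s * s = f x s / s * s\<^sup>2" by (cases "s = 0") (auto simp: power2_eq_square)
  moreover have "f x s / s * s\<^sup>2 \<ge> 0" by (rule mult_nonneg_nonneg[OF ratio_nonneg]) simp
  ultimately show ?thesis by simp
qed

lemma ray_deriv: "((\<lambda>t. F x (t * b)) has_real_derivative f x (t * b) * b) (at t)"
  by (rule DERIV_chain2[OF F_deriv]) (auto intro!: derivative_eq_intros)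

text \<open>Along the ray through \<open>b\<close> the derivative of \<open>F\<close> is \<open>f x (t * b) * b\<close>, which has the sign of \<open>t\<close>.\<close>

lemma F_nonneg: "F x b \<ge> 0"
proof -
  have "F x (0 * b) \<le> F x (1 * b)"
  proof (rule DERIV_nonneg_imp_nondecreasing[where f = "\<lambda>t. F x (t * b)"])
    fix t :: real assume "0 \<le> t" "t \<le> 1"
    then have "f x (t * b) * b \<ge> 0"
      using f_mult_nonneg[of x "t * b"] by (cases "t = 0") (auto simp: zero_le_mult_iff mult_le_0_iff)
    then show "\<exists>y. ((\<lambda>t. F x (t * b)) has_real_derivative y) (at t) \<and> 0 \<le> y"
      using ray_deriv by blast
  qed auto
  then show ?thesis by simp
qed

lemma f_ray:
  assumes "0 < t" "t \<le> 1"
  shows "f x (t * b) * b \<le> t * (f x b * b)" "t < 1 \<Longrightarrow> b \<noteq> 0 \<Longrightarrow> f x (t * b) * b < t * (f x b * b)"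
proof -
  show *: "f x (t * b) * b < t * (f x b * b)" if "t < 1" "b \<noteq> 0"
  proof -
    have "f x (t * b) / (t * b) < f x b / b"
      by (rule ratio) (use that assms in \<open>auto simp: abs_mult zero_less_mult_iff mult_less_0_iff\<close>)
    then have "f x (t * b) / (t * b) * (t * b\<^sup>2) < f x b / b * (t * b\<^sup>2)"
      using assms that by (intro mult_strict_right_mono) auto
    then show ?thesis using assms that by (simp add: power2_eq_square field_simps)
  qed
  then show "f x (t * b) * b \<le> t * (f x b * b)"
    using assms by (cases "t < 1 \<and> b \<noteq> 0") auto
qed

lemma f_ray_ge:
  assumes "1 \<le> t"
  shows "f x (t * b) * b \<ge> t * (f x b * b)" "t > 1 \<Longrightarrow> b \<noteq> 0 \<Longrightarrow> f x (t * b) * b > t * (f x b * b)"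
proof -
  have "t > 0" using assms by simp
  then show "f x (t * b) * b \<ge> t * (f x b * b)"
    using f_ray(1)[where t = "1/t" and x = x and b = "t * b"] assms by (simp add: field_simps)
  show "f x (t * b) * b > t * (f x b * b)" if "t > 1" "b \<noteq> 0"
    using f_ray(2)[where t = "1/t" and x = x and b = "t * b"] that \<open>t > 0\<close> by (simp add: field_simps)
qed

text \<open>In the variable \<open>t\<^sup>2\<close> the function \<open>F x (t * b)\<close> is convex, and the right-hand side is its tangent at
\<open>t = 1\<close>.  All energy comparisons along rays reduce to this inequality.\<close>

lemma F_ray:
  assumes "t \<ge> 0"
  shows "F x (t * b) \<ge> F x b + f x b * b / 2 * (t\<^sup>2 - 1)"
proof -
  define k where "k = (\<lambda>t. F x (t * b) - f x b * b / 2 * t\<^sup>2)"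
  have k': "(k has_real_derivative f x (s * b) * b - s * (f x b * b)) (at s)" for s
    unfolding k_def by (rule derivative_eq_intros ray_deriv refl | simp)+
  have "k 1 \<le> k t"
  proof (cases "t \<le> 1")
    case True
    show ?thesis
    proof (rule DERIV_nonpos_imp_nonincreasing[OF True])
      fix s assume "t \<le> s" "s \<le> 1"
      then have "f x (s * b) * b - s * (f x b * b) \<le> 0"
        using f_ray(1)[of s x b] assms by (cases "s = 0") auto
      then show "\<exists>y. (k has_real_derivative y) (at s) \<and> y \<le> 0" using k' by blast
    qed
  next
    case False
    show ?thesis
    proof (rule DERIV_nonneg_imp_nondecreasing[where f = k])
      fix s assume "1 \<le> s" "s \<le> t"
      then have "f x (s * b) * b - s * (f x b * b) \<ge> 0"
        using f_ray_ge(1)[of s x b] assms by auto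
      then show "\<exists>y. (k has_real_derivative y) (at s) \<and> 0 \<le> y" using k' by blast
    qed (use False in auto)
  qed
  then show ?thesis by (simp add: k_def algebra_simps diff_divide_distrib)
qed

lemma F_le: "F x b \<le> f x b * b / 2"
  using F_ray[of 0 x b] by simp

lemma H_nonneg: "H x b \<ge> 0"
  using F_le by (simp add: H_def)

lemma H_mono:
  assumes "0 \<le> t" "t \<le> 1"
  shows "H x (t * b) \<le> H x b"
proof (cases "t = 0")
  case True
  then show ?thesis using H_nonneg[of x b] by (simp add: H_def)
next
  case False
  have "f x (t * b) * b * t \<le> t * (f x b * b) * t"
    using False assms f_ray(1)[of t x b] by (intro mult_right_mono) auto
  then show ?thesis
    using F_ray[of t x b] assms by (simp add: H_def algebra_simps power2_eq_square diff_divide_distrib)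
qed

text \<open>Strictness comes from comparing with the point halfway down the ray.\<close>

lemma H_pos:
  assumes "b \<noteq> 0"
  shows "H x b > 0"
proof -
  have "H x (1/2 * b) < H x b"
    using f_ray(2)[where t = "1/2" and x = x and b = b] assms F_ray[of "1/2" x b] by (simp add: H_def power2_eq_square)
  then show ?thesis using H_nonneg[of x "1/2 * b"] by linarith
qed

lemma f_bound:
  assumes "\<bar>f x s\<bar> \<le> K * \<bar>s\<bar>"
  shows "f x s * s \<le> K * s\<^sup>2"
proof -
  have "f x s * s \<le> \<bar>f x s\<bar> * \<bar>s\<bar>" by (metis abs_ge_self abs_mult)
  also have "\<dots> \<le> K * \<bar>s\<bar> * \<bar>s\<bar>" by (rule mult_right_mono) (use assms in auto)
  finally show ?thesis by (simp add: power2_eq_square)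
qed

end

section \<open>Square-summable functions\<close>

definition l2 :: "('v \<Rightarrow> real) \<Rightarrow> bool" where
  "l2 u \<longleftrightarrow> (\<lambda>x. (u x)\<^sup>2) summable_on UNIV"

definition sq_norm :: "('v \<Rightarrow> real) \<Rightarrow> real" where
  "sq_norm u = (\<Sum>\<^sub>\<infinity>x. (u x)\<^sup>2)"

text \<open>Removing a finite set of vertices; this replaces the splitting into weak limit and remainder.\<close>

definition off :: "'v set \<Rightarrow> ('v \<Rightarrow> real) \<Rightarrow> 'v \<Rightarrow> real" where
  "off S u = (\<lambda>x. if x \<in> S then 0 else u x)"

lemma summable_dominated:
  fixes g p :: "'a \<Rightarrow> real"
  assumes "p summable_on A" "\<And>x. x \<in> A \<Longrightarrow> \<bar>g x\<bar> \<le> p x"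
  shows "g summable_on A" "(\<lambda>x. \<bar>g x\<bar>) summable_on A"
proof -
  show *: "(\<lambda>x. \<bar>g x\<bar>) summable_on A"
  proof (rule summable_on_comparison_test)
    show "p summable_on A" by fact
  next
    fix x assume "x \<in> A"
    then show "\<bar>g x\<bar> \<le> p x" by (rule assms(2))
  qed (rule abs_ge_zero)
  from * show "g summable_on A"
    by (subst summable_on_iff_abs_summable_on_real) simp
qed

lemma l2_dominated:
  assumes "l2 u" "\<And>x. \<bar>g x\<bar> \<le> K * (u x)\<^sup>2"
  shows "g summable_on UNIV"
  by (rule summable_dominated(1)[of "\<lambda>x. K * (u x)\<^sup>2"])
    (use assms in \<open>auto simp: l2_def intro: summable_on_cmult_right\<close>)

lemma infsum_dominated:
  fixes g p :: "'a \<Rightarrow> real"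
  assumes "p summable_on A" "\<And>x. x \<in> A \<Longrightarrow> \<bar>g x\<bar> \<le> p x"
  shows "\<bar>infsum g A\<bar> \<le> infsum p A"
proof -
  have g: "g summable_on A" by (rule summable_dominated(1)[OF assms])
  have "infsum g A \<le> infsum p A"
    by (rule infsum_mono[OF g assms(1)]) (use assms(2) in \<open>simp add: abs_le_iff\<close>)
  moreover have "infsum (\<lambda>x. - g x) A \<le> infsum p A"
    by (rule infsum_mono[OF iffD2[OF summable_on_uminus g] assms(1)]) (use assms(2) in \<open>simp add: abs_le_iff\<close>)
  ultimately show ?thesis by (simp add: infsum_uminus)
qed

lemma l2_cmult: "l2 u \<Longrightarrow> l2 (\<lambda>x. c * u x)"
  by (simp add: l2_def power_mult_distrib summable_on_cmult_right)

lemma sq_norm_cmult: "sq_norm (\<lambda>x. c * u x) = c\<^sup>2 * sq_norm u"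
  by (simp add: sq_norm_def power_mult_distrib infsum_cmult_right')

lemma square_add_le: "(a + b)\<^sup>2 \<le> 2 * (a\<^sup>2 + (b::real)\<^sup>2)"
  using zero_le_power2[of "a - b"] by (simp add: power2_eq_square algebra_simps)

lemma l2_add: "l2 u \<Longrightarrow> l2 h \<Longrightarrow> l2 (\<lambda>x. u x + h x)"
  unfolding l2_def
  by (rule summable_on_comparison_test[of "\<lambda>x. 2 * ((u x)\<^sup>2 + (h x)\<^sup>2)"])
    (intro summable_on_cmult_right summable_on_add square_add_le zero_le_power2 | assumption)+

lemma l2_mono:
  assumes "l2 u" "\<And>x. \<bar>h x\<bar> \<le> \<bar>u x\<bar>"
  shows "l2 h"
  unfolding l2_def
proof (rule summable_on_comparison_test)
  show "(\<lambda>x. (u x)\<^sup>2) summable_on UNIV" using assms(1) by (simp add: l2_def)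
  show "(h x)\<^sup>2 \<le> (u x)\<^sup>2" for x using assms(2)[of x] by (rule iffD1[OF abs_le_square_iff])
qed simp

lemma l2_off: "l2 u \<Longrightarrow> l2 (off S u)"
  by (erule l2_mono) (auto simp: off_def)

lemma l2_finite: "finite {x. u x \<noteq> 0} \<Longrightarrow> l2 u"
  unfolding l2_def by (rule finite_nonzero_values_imp_summable_on) simp

lemma sq_norm_nonneg [simp]: "sq_norm u \<ge> 0"
  unfolding sq_norm_def by (rule infsum_nonneg) simp

lemma sq_le_sq_norm: "l2 u \<Longrightarrow> (u x)\<^sup>2 \<le> sq_norm u"
  using finite_sum_le_infsum[of "\<lambda>x. (u x)\<^sup>2" UNIV "{x}"] by (simp add: l2_def sq_norm_def)

lemma abs_le_sqrt_sq_norm: "l2 u \<Longrightarrow> \<bar>u x\<bar> \<le> sqrt (sq_norm u)"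
  using real_sqrt_le_mono[OF sq_le_sq_norm[of u x]] by simp

lemma sq_norm_pos: "l2 u \<Longrightarrow> u x \<noteq> 0 \<Longrightarrow> sq_norm u > 0"
  using sq_le_sq_norm[of u x] zero_less_power2[of "u x"] by linarith

lemma l2_mult:
  assumes "l2 u" "l2 h"
  shows "(\<lambda>x. u x * h x) summable_on UNIV" "(\<lambda>x. \<bar>u x * h x\<bar>) summable_on UNIV"
proof -
  have 1: "\<bar>a * b\<bar> \<le> a\<^sup>2 + b\<^sup>2" for a b :: real
  proof -
    have "2 * (\<bar>a\<bar> * \<bar>b\<bar>) \<le> a\<^sup>2 + b\<^sup>2"
      using sum_squares_bound[of "\<bar>a\<bar>" "\<bar>b\<bar>"] by simp
    moreover have "0 \<le> \<bar>a\<bar> * \<bar>b\<bar>" by simp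
    ultimately have "\<bar>a\<bar> * \<bar>b\<bar> \<le> a\<^sup>2 + b\<^sup>2" by linarith
    then show ?thesis by (simp add: abs_mult)
  qed
  have 2: "(\<lambda>x. (u x)\<^sup>2 + (h x)\<^sup>2) summable_on UNIV"
    using assms by (auto simp: l2_def intro: summable_on_add)
  show "(\<lambda>x. u x * h x) summable_on UNIV" "(\<lambda>x. \<bar>u x * h x\<bar>) summable_on UNIV"
    using summable_dominated[OF 2, of "\<lambda>x. u x * h x"] 1 by auto
qed

lemma cauchy_schwarz:
  assumes "l2 u" "l2 h"
  shows "(\<Sum>\<^sub>\<infinity>x. \<bar>u x * h x\<bar>) \<le> sqrt (sq_norm u) * sqrt (sq_norm h)"
proof (rule infsum_le_finite_sums[OF l2_mult(2)[OF assms]])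
  fix S :: "'a set" assume S: "finite S"
  have "(\<Sum>x\<in>S. \<bar>u x * h x\<bar>)\<^sup>2 \<le> (\<Sum>x\<in>S. (u x)\<^sup>2) * (\<Sum>x\<in>S. (h x)\<^sup>2)"
    using Cauchy_Schwarz_ineq_sum[of "\<lambda>x. \<bar>u x\<bar>" "\<lambda>x. \<bar>h x\<bar>" S] by (simp add: abs_mult)
  also have "\<dots> \<le> sq_norm u * sq_norm h"
    using assms S unfolding sq_norm_def l2_def
    by (intro mult_mono finite_sum_le_infsum infsum_nonneg sum_nonneg) auto
  finally show "(\<Sum>x\<in>S. \<bar>u x * h x\<bar>) \<le> sqrt (sq_norm u) * sqrt (sq_norm h)"
    by (metis real_le_rsqrt real_sqrt_mult)
qed

lemma infsum_split:
  fixes g :: "'v \<Rightarrow> real"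
  assumes "g summable_on UNIV" "finite S"
  shows "(\<Sum>\<^sub>\<infinity>x. g x) = (\<Sum>x\<in>S. g x) + (\<Sum>\<^sub>\<infinity>x. off S g x)"
proof -
  have "infsum g (S \<union> - S) = infsum g S + infsum g (- S)"
    using assms by (intro infsum_Un_disjoint) (auto intro: summable_on_subset)
  moreover have "infsum g (- S) = infsum (off S g) UNIV"
    by (rule infsum_cong_neutral) (auto simp: off_def)
  ultimately show ?thesis using assms by simp
qed

text \<open>The bound is stated for all finite supersets so that a prescribed vertex can be added to the set.\<close>

lemma small_tail:
  assumes "l2 u" "e > 0"
  obtains S where "finite S" "\<And>T. finite T \<Longrightarrow> S \<subseteq> T \<Longrightarrow> sq_norm (off T u) \<le> e"
proof -
  obtain S where S: "finite S" "dist (\<Sum>x\<in>S. (u x)\<^sup>2) (sq_norm u) \<le> e"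
    using infsum_finite_approximation[of "\<lambda>x. (u x)\<^sup>2" UNIV e] assms
    by (auto simp: l2_def sq_norm_def)
  show thesis
  proof
    fix T :: "'a set" assume T: "finite T" "S \<subseteq> T"
    have "(\<Sum>x\<in>S. (u x)\<^sup>2) \<le> (\<Sum>x\<in>T. (u x)\<^sup>2)" by (rule sum_mono2) (use T in auto)
    moreover have "(\<lambda>x. (off T u x)\<^sup>2) = off T (\<lambda>x. (u x)\<^sup>2)" by (auto simp: off_def)
    then have "sq_norm u = (\<Sum>x\<in>T. (u x)\<^sup>2) + sq_norm (off T u)"
      using infsum_split[of "\<lambda>x. (u x)\<^sup>2" T] assms T by (simp add: sq_norm_def l2_def)
    ultimately show "sq_norm (off T u) \<le> e" using S(2) by (auto simp: dist_real_def)
  qed (rule S)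
qed

text \<open>Pointwise limits pass to finite partial sums, and the terms are nonnegative.\<close>

lemma fatou:
  fixes g :: "nat \<Rightarrow> 'v \<Rightarrow> real"
  assumes "\<And>n x. g n x \<ge> 0" "\<And>n. g n summable_on UNIV" "\<And>n. infsum (g n) UNIV \<le> a n" "a \<longlonglongrightarrow> c"
    and "\<And>x. (\<lambda>n. g n x) \<longlonglongrightarrow> g0 x"
  shows "g0 summable_on UNIV" "infsum g0 UNIV \<le> c"
proof -
  have *: "sum g0 S \<le> c" if "finite S" for S
  proof (rule LIMSEQ_le)
    show "(\<lambda>n. sum (g n) S) \<longlonglongrightarrow> sum g0 S" by (rule tendsto_sum) (rule assms)
    have "sum (g n) S \<le> a n" for n
      using finite_sum_le_infsum[OF assms(2) that, of n] assms(1,3)[of n] order_trans by fastforce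
    then show "\<exists>N. \<forall>n\<ge>N. sum (g n) S \<le> a n" by blast
  qed (rule assms)
  have "g0 x \<ge> 0" for x
    by (rule LIMSEQ_le_const[OF assms(5)]) (use assms(1) in auto)
  then show "g0 summable_on UNIV"
    by (intro nonneg_bdd_above_summable_on bdd_aboveI2[of _ _ c]) (use * in auto)
  then show "infsum g0 UNIV \<le> c" by (rule infsum_le_finite_sums) (use * in auto)
qed

text \<open>Vertices outside the supports carry the constant value \<open>0\<close>, and the supports of countably many
square-summable functions have a countable union, to which the diagonal argument applies.
Boundedness in \<open>\<ell>\<^sup>2\<close> gives pointwise bounds, and Fatou returns the limit to \<open>\<ell>\<^sup>2\<close>.\<close>

lemma weak_subsequence:
  assumes "\<And>n. l2 (u n)" "\<And>n. sq_norm (u n) \<le> M"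
  obtains k v where "strict_mono (k :: nat \<Rightarrow> nat)" "l2 v" "\<And>x. (\<lambda>n. u (k n) x) \<longlonglongrightarrow> v x"
proof -
  define C where "C = (\<Union>n. {x. u n x \<noteq> 0})"
  have "countable {x. u n x \<noteq> 0}" for n
    using summable_countable_real[of "\<lambda>x. (u n x)\<^sup>2" UNIV] assms(1) by (simp add: l2_def)
  then have "countable C" unfolding C_def by blast
  moreover have "norm (u n x) \<le> sqrt M" for n x
    using abs_le_sqrt_sq_norm[OF assms(1)] real_sqrt_le_mono[OF assms(2)] order_trans
    by (metis real_norm_def)
  ultimately obtain k where k: "strict_mono (k :: nat \<Rightarrow> nat)"
    "\<And>x. x \<in> C \<Longrightarrow> \<exists>l. (\<lambda>n. u (k n) x) \<longlonglongrightarrow> l"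
    using function_convergent_subsequence[of C u "sqrt M"] by metis
  have "\<exists>l. (\<lambda>n. u (k n) x) \<longlonglongrightarrow> l" for x
  proof (cases "x \<in> C")
    case False
    then have "(\<lambda>n. u (k n) x) = (\<lambda>n. 0)" by (auto simp: C_def)
    then show ?thesis by (metis tendsto_const)
  qed (rule k)
  then obtain v where v: "\<And>x. (\<lambda>n. u (k n) x) \<longlonglongrightarrow> v x" by metis
  have "l2 v" unfolding l2_def
    by (rule fatou(1)[of "\<lambda>n x. (u (k n) x)\<^sup>2" "\<lambda>_. M" M])
      (use assms v in \<open>auto simp: l2_def sq_norm_def intro!: tendsto_intros\<close>)
  then show thesis using that k v by blast
qed

lemma continuous_on_infsum_param:
  fixes g :: "'v \<Rightarrow> real \<Rightarrow> real"
  assumes "p summable_on UNIV" "\<And>x t. t \<in> Y \<Longrightarrow> \<bar>g x t\<bar> \<le> p x" "\<And>x. continuous_on Y (g x)"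
  shows "continuous_on Y (\<lambda>t. \<Sum>\<^sub>\<infinity>x. g x t)"
proof (rule uniform_limit_theorem)
  show "uniform_limit Y (\<lambda>X t. \<Sum>x\<in>X. g x t) (\<lambda>t. \<Sum>\<^sub>\<infinity>x. g x t) (finite_subsets_at_top UNIV)"
    by (rule Weierstrass_m_test_general[OF _ assms(1)]) (use assms in auto)
  show "\<forall>\<^sub>F X in finite_subsets_at_top UNIV. continuous_on Y (\<lambda>t. \<Sum>x\<in>X. g x t)"
    by (intro always_eventually allI continuous_on_sum assms)
qed simp

section \<open>The Laplacian on graphs of bounded degree\<close>

locale bounded_degree_graph =
  fixes adj :: "'v \<Rightarrow> 'v \<Rightarrow> bool" and D :: nat
  assumes sym: "symp adj" and finite_nbrs [simp]: "\<And>x. finite {y. adj x y}"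
    and degree: "\<And>x. card {y. adj x y} \<le> D"
begin

abbreviation deg where "deg x \<equiv> real (card {y. adj x y})"

definition adj_sum where "adj_sum u x = (\<Sum>y\<in>{y. adj x y}. u y)" for u :: "'v \<Rightarrow> real"

abbreviation edges where "edges \<equiv> SIGMA x:UNIV. {y. adj x y}"

lemma deg_le: "deg x \<le> D"
  using degree by simp

lemma swap_bij: "bij_betw prod.swap edges edges"
  by (rule bij_betwI[where g = prod.swap]) (use sym in \<open>auto dest: sympD\<close>)

text \<open>Reversing oriented edges is a bijection; this is the discrete integration by parts behind all the
identities for the Laplacian.\<close>

lemma edge_sum_swap:
  fixes g :: "'v \<times> 'v \<Rightarrow> real"
  assumes "g summable_on edges"
  shows "(\<lambda>x. \<Sum>y\<in>{y. adj x y}. g (x, y)) summable_on UNIV"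
    and "(\<lambda>x. \<Sum>y\<in>{y. adj x y}. g (y, x)) summable_on UNIV"
    and "(\<Sum>\<^sub>\<infinity>x. \<Sum>y\<in>{y. adj x y}. g (x, y)) = (\<Sum>\<^sub>\<infinity>x. \<Sum>y\<in>{y. adj x y}. g (y, x))"
proof -
  have *: "(\<lambda>x. \<Sum>y\<in>{y. adj x y}. k (x, y)) summable_on UNIV"
    "(\<Sum>\<^sub>\<infinity>x. \<Sum>y\<in>{y. adj x y}. k (x, y)) = infsum k edges" if "k summable_on edges" for k :: "'v \<times> 'v \<Rightarrow> real"
  proof -
    have **: "k summable_on Sigma UNIV (\<lambda>x. {y. adj x y})" using that .
    show "(\<lambda>x. \<Sum>y\<in>{y. adj x y}. k (x, y)) summable_on UNIV"
      using summable_on_Sigma_banach[of "\<lambda>x y. k (x, y)" UNIV "\<lambda>x. {y. adj x y}"] ** by simp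
    show "(\<Sum>\<^sub>\<infinity>x. \<Sum>y\<in>{y. adj x y}. k (x, y)) = infsum k edges"
      using infsum_Sigma_banach[OF **] by simp
  qed
  have swap: "(\<lambda>e. g (prod.swap e)) summable_on edges" "(\<Sum>\<^sub>\<infinity>e\<in>edges. g (prod.swap e)) = infsum g edges"
    using assms summable_on_reindex_bij_betw[OF swap_bij] infsum_reindex_bij_betw[OF swap_bij] by auto
  show "(\<lambda>x. \<Sum>y\<in>{y. adj x y}. g (x, y)) summable_on UNIV"
    "(\<lambda>x. \<Sum>y\<in>{y. adj x y}. g (y, x)) summable_on UNIV"
    "(\<Sum>\<^sub>\<infinity>x. \<Sum>y\<in>{y. adj x y}. g (x, y)) = (\<Sum>\<^sub>\<infinity>x. \<Sum>y\<in>{y. adj x y}. g (y, x))"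
    using *[OF assms] *[OF swap(1)] swap(2) by simp_all
qed

lemma edge_summable:
  fixes p :: "'v \<Rightarrow> real"
  assumes "p summable_on UNIV"
  shows "(\<lambda>e. p (fst e)) summable_on edges" "(\<lambda>e. p (snd e)) summable_on edges"
proof -
  have p: "(\<lambda>x. \<bar>p x\<bar>) summable_on UNIV"
    using iffD1[OF summable_on_iff_abs_summable_on_real assms] by simp
  have "(\<lambda>x. deg x * \<bar>p x\<bar>) summable_on UNIV"
  proof (rule summable_on_comparison_test)
    show "(\<lambda>x. D * \<bar>p x\<bar>) summable_on UNIV" by (rule summable_on_cmult_right) (rule p)
    show "deg x * \<bar>p x\<bar> \<le> D * \<bar>p x\<bar>" for x by (rule mult_right_mono[OF deg_le]) simp
  qed simp
  then have "(\<lambda>e. norm (p (fst e))) summable_on edges"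
    by (subst Infinite_Sum.abs_summable_on_Sigma_iff) simp
  then show *: "(\<lambda>e. p (fst e)) summable_on edges"
    by (rule iffD2[OF summable_on_iff_abs_summable_on_real])
  show "(\<lambda>e. p (snd e)) summable_on edges"
    using summable_on_reindex_bij_betw[OF swap_bij, of "\<lambda>e. p (fst e)"] * by simp
qed

lemma adj_sum_summation:
  assumes "p summable_on UNIV"
  shows "adj_sum p summable_on UNIV" "(\<Sum>\<^sub>\<infinity>x. adj_sum p x) = (\<Sum>\<^sub>\<infinity>x. deg x * p x)"
    "(\<lambda>x. deg x * p x) summable_on UNIV"
  using edge_sum_swap[OF edge_summable(1)[OF assms]] by (auto simp: adj_sum_def[abs_def])

lemma adj_sum_sym:
  assumes "l2 u" "l2 h"
  shows "(\<Sum>\<^sub>\<infinity>x. h x * adj_sum u x) = (\<Sum>\<^sub>\<infinity>x. u x * adj_sum h x)"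
proof -
  have "(\<lambda>e. h (fst e) * u (snd e)) summable_on edges"
  proof (rule summable_dominated(1))
    show "(\<lambda>e. (h (fst e))\<^sup>2 + (u (snd e))\<^sup>2) summable_on edges"
      using assms edge_summable(1)[of "\<lambda>x. (h x)\<^sup>2"] edge_summable(2)[of "\<lambda>x. (u x)\<^sup>2"]
      by (intro summable_on_add) (auto simp: l2_def)
  next
    fix e
    have "2 * (\<bar>h (fst e)\<bar> * \<bar>u (snd e)\<bar>) \<le> (h (fst e))\<^sup>2 + (u (snd e))\<^sup>2"
      using sum_squares_bound[of "\<bar>h (fst e)\<bar>" "\<bar>u (snd e)\<bar>"] by simp
    moreover have "0 \<le> \<bar>h (fst e)\<bar> * \<bar>u (snd e)\<bar>" by simp
    ultimately show "\<bar>h (fst e) * u (snd e)\<bar> \<le> (h (fst e))\<^sup>2 + (u (snd e))\<^sup>2"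
      by (simp only: abs_mult)
  qed
  from edge_sum_swap(3)[OF this] show ?thesis
    by (simp add: adj_sum_def sum_distrib_left mult.commute)
qed

lemma l2_adj_sum:
  assumes "l2 u"
  shows "l2 (adj_sum u)"
  unfolding l2_def
proof (rule summable_on_comparison_test)
  show "(\<lambda>x. D * adj_sum (\<lambda>x. (u x)\<^sup>2) x) summable_on UNIV"
    using assms by (intro summable_on_cmult_right adj_sum_summation) (simp add: l2_def)
  fix x
  have "(adj_sum u x)\<^sup>2 \<le> deg x * adj_sum (\<lambda>x. (u x)\<^sup>2) x"
    unfolding adj_sum_def by (subst mult.commute) (rule sum_squared_le_sum_of_squares)
  also have "\<dots> \<le> D * adj_sum (\<lambda>x. (u x)\<^sup>2) x"
    unfolding adj_sum_def by (intro mult_right_mono deg_le sum_nonneg) simp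
  finally show "(adj_sum u x)\<^sup>2 \<le> D * adj_sum (\<lambda>x. (u x)\<^sup>2) x" .
qed simp

lemma laplacian_eq: "laplacian adj u x = adj_sum u x - deg x * u x"
  by (simp add: laplacian_def adj_sum_def sum_subtractf)

lemma l2_deg: "l2 u \<Longrightarrow> l2 (\<lambda>x. deg x * u x)"
  by (rule l2_mono[OF l2_cmult[of u "real D"]]) (auto simp: abs_mult intro: mult_right_mono deg_le)

lemma l2_diff: "l2 u \<Longrightarrow> l2 h \<Longrightarrow> l2 (\<lambda>x. u x - h x)"
  using l2_add[of u "\<lambda>x. - 1 * h x"] l2_cmult[of h "- 1"] by simp

lemma l2_laplacian: "l2 u \<Longrightarrow> l2 (laplacian adj u)"
  using l2_diff[OF l2_adj_sum l2_deg] by (simp add: laplacian_eq[abs_def])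

lemma grad_sq_eq: "grad_sq adj u x = adj_sum (\<lambda>x. (u x)\<^sup>2) x - 2 * (u x * adj_sum u x) + deg x * (u x)\<^sup>2"
  by (simp add: grad_sq_def adj_sum_def power2_diff sum.distrib sum_subtractf sum_distrib_left mult.assoc mult.left_commute mult.commute)

lemma grad_sq_nonneg: "grad_sq adj u x \<ge> 0"
  unfolding grad_sq_def by (rule sum_nonneg) simp

lemma grad_sq_sum:
  assumes "l2 u"
  shows "grad_sq adj u summable_on UNIV"
    and "1/2 * (\<Sum>\<^sub>\<infinity>x. grad_sq adj u x) = (\<Sum>\<^sub>\<infinity>x. u x * - laplacian adj u x)"
    and "1/2 * (\<Sum>\<^sub>\<infinity>x. grad_sq adj u x) \<le> 2 * D * sq_norm u"
proof -
  have u2: "(\<lambda>x. (u x)\<^sup>2) summable_on UNIV" using assms by (simp add: l2_def)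
  note s = adj_sum_summation[OF u2] l2_mult(1)[OF assms l2_adj_sum[OF assms]]
  have 1: "grad_sq adj u = (\<lambda>x. adj_sum (\<lambda>x. (u x)\<^sup>2) x + - 2 * (u x * adj_sum u x) + deg x * (u x)\<^sup>2)"
    by (auto simp: grad_sq_eq)
  show summ: "grad_sq adj u summable_on UNIV"
    unfolding 1 by (intro summable_on_add summable_on_cmult_right s)
  have 2: "(\<Sum>\<^sub>\<infinity>x. grad_sq adj u x) =
      (\<Sum>\<^sub>\<infinity>x. adj_sum (\<lambda>x. (u x)\<^sup>2) x) + - 2 * (\<Sum>\<^sub>\<infinity>x. u x * adj_sum u x) + (\<Sum>\<^sub>\<infinity>x. deg x * (u x)\<^sup>2)"
    unfolding 1 by (subst infsum_add infsum_cmult_right', (intro summable_on_add summable_on_cmult_right s)+)+ (simp only: infsum_cmult_right')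
  have "(\<Sum>\<^sub>\<infinity>x. u x * - laplacian adj u x) = (\<Sum>\<^sub>\<infinity>x. deg x * (u x)\<^sup>2 + - 1 * (u x * adj_sum u x))"
    by (rule infsum_cong) (simp add: laplacian_eq algebra_simps power2_eq_square)
  also have "\<dots> = (\<Sum>\<^sub>\<infinity>x. deg x * (u x)\<^sup>2) + - 1 * (\<Sum>\<^sub>\<infinity>x. u x * adj_sum u x)"
    by (subst infsum_add, (intro summable_on_cmult_right s)+) (simp only: infsum_cmult_right')
  finally show "1/2 * (\<Sum>\<^sub>\<infinity>x. grad_sq adj u x) = (\<Sum>\<^sub>\<infinity>x. u x * - laplacian adj u x)"
    unfolding 2 s(2) by simp
  have 3: "(\<Sum>\<^sub>\<infinity>x. deg x * (u x)\<^sup>2) \<le> D * sq_norm u"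
    unfolding sq_norm_def infsum_cmult_right'[symmetric]
    by (intro infsum_mono summable_on_cmult_right u2 s mult_right_mono deg_le) simp
  have "(\<Sum>\<^sub>\<infinity>x. grad_sq adj u x) \<le> (\<Sum>\<^sub>\<infinity>x. 2 * (adj_sum (\<lambda>x. (u x)\<^sup>2) x + deg x * (u x)\<^sup>2))"
  proof (rule infsum_mono[OF summ])
    show "(\<lambda>x. 2 * (adj_sum (\<lambda>x. (u x)\<^sup>2) x + deg x * (u x)\<^sup>2)) summable_on UNIV"
      by (intro summable_on_cmult_right summable_on_add s)
    fix x
    have "grad_sq adj u x \<le> (\<Sum>y\<in>{y. adj x y}. 2 * ((u y)\<^sup>2 + (u x)\<^sup>2))"
      unfolding grad_sq_def
    proof (rule sum_mono)
      fix y
      show "(u y - u x)\<^sup>2 \<le> 2 * ((u y)\<^sup>2 + (u x)\<^sup>2)"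
        using square_add_le[of "u y" "- u x"] by simp
    qed
    then show "grad_sq adj u x \<le> 2 * (adj_sum (\<lambda>x. (u x)\<^sup>2) x + deg x * (u x)\<^sup>2)"
      by (simp add: adj_sum_def sum_distrib_left[symmetric] sum.distrib)
  qed
  also have "\<dots> = 2 * ((\<Sum>\<^sub>\<infinity>x. adj_sum (\<lambda>x. (u x)\<^sup>2) x) + (\<Sum>\<^sub>\<infinity>x. deg x * (u x)\<^sup>2))"
    by (simp only: infsum_cmult_right' infsum_add[OF s(1) s(3)])
  finally show "1/2 * (\<Sum>\<^sub>\<infinity>x. grad_sq adj u x) \<le> 2 * D * sq_norm u"
    using 3 unfolding s(2) by simp
qed

lemma H1_norm_bounds:
  assumes "l2 u"
  shows "sqrt (sq_norm u) \<le> H1_norm adj u" "H1_norm adj u \<le> sqrt (1 + 2 * D) * sqrt (sq_norm u)"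
proof -
  have "0 \<le> (\<Sum>\<^sub>\<infinity>x. grad_sq adj u x)" by (rule infsum_nonneg) (rule grad_sq_nonneg)
  then show "sqrt (sq_norm u) \<le> H1_norm adj u"
    unfolding H1_norm_def sq_norm_def by (intro real_sqrt_le_mono) simp
  show "H1_norm adj u \<le> sqrt (1 + 2 * D) * sqrt (sq_norm u)"
    unfolding H1_norm_def real_sqrt_mult[symmetric]
    using grad_sq_sum(3)[OF assms] by (intro real_sqrt_le_mono) (simp add: algebra_simps sq_norm_def[symmetric])
qed

text \<open>Bounded degree makes the \<open>H\<^sup>1\<close> norm equivalent to the \<open>\<ell>\<^sup>2\<close> norm, and truncations to finite sets
approximate in the latter.\<close>

lemma H1_eq: "H1 adj = {u. l2 u}"
proof
  show "H1 adj \<subseteq> {u. l2 u}" by (auto simp: H1_def l2_def)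
  show "{u. l2 u} \<subseteq> H1 adj"
  proof
    fix u :: "'v \<Rightarrow> real" assume "u \<in> {u. l2 u}"
    then have u: "l2 u" by simp
    have "\<exists>S. finite S \<and> sq_norm (off S u) \<le> 1 / (real n + 1)" for n :: nat
      using small_tail[OF u, of "1 / (real n + 1)"] by (metis of_nat_0_le_iff add_nonneg_pos zero_less_divide_1_iff zero_less_one order_refl)
    then obtain S where S: "\<And>n. finite (S n)" "\<And>n :: nat. sq_norm (off (S n) u) \<le> 1 / (real n + 1)"
      by metis
    define \<phi> where "\<phi> = (\<lambda>n x. if x \<in> S n then u x else 0)"
    have fin: "finite {x. \<phi> n x \<noteq> 0}" for n
      by (rule finite_subset[OF _ S(1)[of n]]) (auto simp: \<phi>_def)
    have eq: "(\<lambda>x. \<phi> n x - u x) = (\<lambda>x. - 1 * off (S n) u x)" for n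
      by (auto simp: \<phi>_def off_def)
    have lim: "(\<lambda>n. H1_norm adj (\<lambda>x. \<phi> n x - u x)) \<longlonglongrightarrow> 0"
    proof (rule tendsto_sandwich[OF _ _ tendsto_const])
      show "\<forall>\<^sub>F n in sequentially. 0 \<le> H1_norm adj (\<lambda>x. \<phi> n x - u x)"
        unfolding H1_norm_def
        by (intro always_eventually allI real_sqrt_ge_zero add_nonneg_nonneg mult_nonneg_nonneg infsum_nonneg grad_sq_nonneg) auto
      show "\<forall>\<^sub>F n in sequentially. H1_norm adj (\<lambda>x. \<phi> n x - u x) \<le> sqrt (1 + 2 * D) * sqrt (1 / (real n + 1))"
      proof (intro always_eventually allI)
        fix n
        have "H1_norm adj (\<lambda>x. \<phi> n x - u x) \<le> sqrt (1 + 2 * D) * sqrt (sq_norm (\<lambda>x. \<phi> n x - u x))"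
          by (rule H1_norm_bounds) (unfold eq, intro l2_cmult l2_off u)
        also have "sq_norm (\<lambda>x. \<phi> n x - u x) = sq_norm (off (S n) u)"
          unfolding eq sq_norm_cmult by simp
        also have "sqrt (1 + 2 * D) * sqrt \<dots> \<le> sqrt (1 + 2 * D) * sqrt (1 / (real n + 1))"
          by (intro mult_left_mono real_sqrt_le_mono S) simp
        finally show "H1_norm adj (\<lambda>x. \<phi> n x - u x) \<le> sqrt (1 + 2 * D) * sqrt (1 / (real n + 1))" .
      qed
      have "(\<lambda>n. sqrt (1 + 2 * D) * sqrt (1 / (real n + 1))) \<longlonglongrightarrow> sqrt (1 + 2 * D) * sqrt 0"
        using LIMSEQ_inverse_real_of_nat by (intro tendsto_intros) (simp add: inverse_eq_divide add.commute)
      then show "(\<lambda>n. sqrt (1 + 2 * D) * sqrt (1 / (real n + 1))) \<longlonglongrightarrow> 0" by simp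
    qed
    show "u \<in> H1 adj"
      unfolding H1_def using u grad_sq_sum(1)[OF u] fin lim by (auto simp: l2_def intro!: exI[of _ \<phi>])
  qed
qed

end

section \<open>The quadratic form of a Schroedinger operator\<close>

locale schroedinger = bounded_degree_graph adj D
  for adj :: "'v \<Rightarrow> 'v \<Rightarrow> bool" and D :: nat +
  fixes V :: "'v \<Rightarrow> real" and V0 V1 :: real
  assumes V0: "V0 > 0" and V_ge: "\<And>x. V0 \<le> V x" and V_le: "\<And>x. V x \<le> V1"
begin

definition L where "L u x = - laplacian adj u x + V x * u x"

definition Q where "Q u = (\<Sum>\<^sub>\<infinity>x. 1/2 * grad_sq adj u x + V x * (u x)\<^sup>2)"

lemma l2_V: 
  assumes "l2 u"
  shows "l2 (\<lambda>x. V x * u x)"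
proof (rule l2_mono[OF l2_cmult[of u V1]])
  show "\<bar>V x * u x\<bar> \<le> \<bar>V1 * u x\<bar>" for x
    using V0 V_ge[of x] V_le[of x] by (simp add: abs_mult mult_right_mono)
qed fact

lemma V_sq_summable: "l2 u \<Longrightarrow> (\<lambda>x. V x * (u x)\<^sup>2) summable_on UNIV"
  using l2_mult(1)[OF l2_V, of u u] by (simp add: power2_eq_square mult.assoc)

lemma l2_L: "l2 u \<Longrightarrow> l2 (L u)"
  using l2_add[OF l2_cmult[OF l2_laplacian, of u "- 1"] l2_V] by (simp add: L_def[abs_def])

lemma L_add: "L (\<lambda>x. u x + h x) x = L u x + L h x"
  by (simp add: L_def laplacian_eq adj_sum_def sum.distrib algebra_simps)

lemma Q_split:
  assumes "l2 u"
  shows "Q u = 1/2 * (\<Sum>\<^sub>\<infinity>x. grad_sq adj u x) + (\<Sum>\<^sub>\<infinity>x. V x * (u x)\<^sup>2)"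
  unfolding Q_def infsum_cmult_right'[symmetric]
  by (intro infsum_add summable_on_cmult_right grad_sq_sum V_sq_summable assms)

lemma Q_eq: 
  assumes "l2 u"
  shows "Q u = (\<Sum>\<^sub>\<infinity>x. u x * L u x)"
proof -
  have "(\<Sum>\<^sub>\<infinity>x. u x * L u x) = (\<Sum>\<^sub>\<infinity>x. - 1 * (u x * laplacian adj u x) + V x * (u x)\<^sup>2)"
    by (rule infsum_cong) (simp add: L_def algebra_simps power2_eq_square)
  also have "\<dots> = - 1 * (\<Sum>\<^sub>\<infinity>x. u x * laplacian adj u x) + (\<Sum>\<^sub>\<infinity>x. V x * (u x)\<^sup>2)"
    unfolding infsum_cmult_right'[symmetric]
    by (intro infsum_add summable_on_cmult_right l2_mult l2_laplacian V_sq_summable assms)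
  finally show ?thesis
    unfolding Q_split[OF assms] grad_sq_sum(2)[OF assms] by (simp add: infsum_uminus)
qed

lemma L_sym:
  assumes "l2 u" "l2 h"
  shows "(\<Sum>\<^sub>\<infinity>x. h x * L u x) = (\<Sum>\<^sub>\<infinity>x. u x * L h x)"
proof -
  have *: "(\<Sum>\<^sub>\<infinity>x. h x * L u x) = (\<Sum>\<^sub>\<infinity>x. (deg x + V x) * (u x * h x)) + - 1 * (\<Sum>\<^sub>\<infinity>x. h x * adj_sum u x)"
    if "l2 u" "l2 h" for u h
  proof -
    have "(\<lambda>x. h x * (deg x * u x + V x * u x)) summable_on UNIV"
      using that by (intro l2_mult l2_add l2_deg l2_V)
    then have "(\<lambda>x. (deg x + V x) * (u x * h x)) summable_on UNIV"
      by (simp add: algebra_simps)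
    then have "(\<Sum>\<^sub>\<infinity>x. (deg x + V x) * (u x * h x) + - 1 * (h x * adj_sum u x)) =
        (\<Sum>\<^sub>\<infinity>x. (deg x + V x) * (u x * h x)) + (\<Sum>\<^sub>\<infinity>x. - 1 * (h x * adj_sum u x))"
      by (rule infsum_add) (intro summable_on_cmult_right l2_mult l2_adj_sum that)
    moreover have "(\<Sum>\<^sub>\<infinity>x. h x * L u x) = (\<Sum>\<^sub>\<infinity>x. (deg x + V x) * (u x * h x) + - 1 * (h x * adj_sum u x))"
      by (rule infsum_cong) (simp add: L_def laplacian_eq algebra_simps)
    ultimately show ?thesis by (simp only: infsum_cmult_right')
  qed
  show ?thesis
    using *[OF assms] *[OF assms(2,1)] adj_sum_sym[OF assms] by (simp add: mult.commute)
qed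

lemma Q_add:
  assumes "l2 u" "l2 h"
  shows "Q (\<lambda>x. u x + h x) = Q u + 2 * (\<Sum>\<^sub>\<infinity>x. h x * L u x) + Q h"
proof -
  note s = l2_mult(1)[OF _ l2_L]
  have "Q (\<lambda>x. u x + h x) = (\<Sum>\<^sub>\<infinity>x. (u x * L u x + h x * L u x) + (u x * L h x + h x * L h x))"
    unfolding Q_eq[OF l2_add[OF assms]] L_add by (rule infsum_cong) (simp add: algebra_simps)
  also have "\<dots> = ((\<Sum>\<^sub>\<infinity>x. u x * L u x) + (\<Sum>\<^sub>\<infinity>x. h x * L u x)) + ((\<Sum>\<^sub>\<infinity>x. u x * L h x) + (\<Sum>\<^sub>\<infinity>x. h x * L h x))"
    by (subst infsum_add, (intro summable_on_add s assms)+)+ (rule refl)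
  finally show ?thesis
    unfolding Q_eq[OF assms(1)] Q_eq[OF assms(2)] L_sym[OF assms] by simp
qed

lemma Q_cmult: "Q (\<lambda>x. c * u x) = c\<^sup>2 * Q u"
proof -
  have "grad_sq adj (\<lambda>x. c * u x) x = c\<^sup>2 * grad_sq adj u x" for x
    by (simp add: grad_sq_def sum_distrib_left right_diff_distrib[symmetric] power_mult_distrib)
  then have "1/2 * grad_sq adj (\<lambda>x. c * u x) x + V x * (c * u x)\<^sup>2 = c\<^sup>2 * (1/2 * grad_sq adj u x + V x * (u x)\<^sup>2)" for x
    by (simp add: algebra_simps power_mult_distrib)
  then show ?thesis unfolding Q_def by (simp only: infsum_cmult_right')
qed

lemma Q_ge:
  assumes "l2 u"
  shows "V0 * sq_norm u \<le> Q u"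
proof -
  have "V0 * sq_norm u = (\<Sum>\<^sub>\<infinity>x. V0 * (u x)\<^sup>2)" by (simp add: sq_norm_def infsum_cmult_right')
  also have "\<dots> \<le> (\<Sum>\<^sub>\<infinity>x. V x * (u x)\<^sup>2)"
    using assms by (intro infsum_mono V_sq_summable summable_on_cmult_right mult_right_mono V_ge) (auto simp: l2_def)
  also have "\<dots> \<le> Q u"
    using infsum_nonneg[of UNIV "grad_sq adj u"] grad_sq_nonneg unfolding Q_split[OF assms] by simp
  finally show ?thesis .
qed

lemma Q_le:
  assumes "l2 u"
  shows "Q u \<le> (2 * D + V1) * sq_norm u"
proof -
  have "(\<Sum>\<^sub>\<infinity>x. V x * (u x)\<^sup>2) \<le> (\<Sum>\<^sub>\<infinity>x. V1 * (u x)\<^sup>2)"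
    using assms by (intro infsum_mono V_sq_summable summable_on_cmult_right mult_right_mono V_le) (auto simp: l2_def)
  also have "\<dots> = V1 * sq_norm u" by (simp add: sq_norm_def infsum_cmult_right')
  finally show ?thesis
    using grad_sq_sum(3)[OF assms] unfolding Q_split[OF assms] by (simp add: algebra_simps)
qed

lemma L_tendsto:
  assumes "\<And>x. (\<lambda>n. u n x) \<longlonglongrightarrow> v x"
  shows "(\<lambda>n. L (u n) x) \<longlonglongrightarrow> L v x"
  unfolding L_def laplacian_def by (intro tendsto_intros assms)

text \<open>The forms of the functions themselves need not converge, since mass may escape to infinity.
Removing \<open>S\<close> changes the form only by sums over \<open>S\<close> and its neighbours, and these depend continuously
on finitely many values.\<close>

lemma Q_off_tendsto:
  assumes "\<And>n. l2 (u n)" "l2 v" "\<And>x. (\<lambda>n. u n x) \<longlonglongrightarrow> v x" "finite S"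
  shows "(\<lambda>n. Q (off S (u n)) - Q (u n)) \<longlonglongrightarrow> Q (off S v) - Q v"
proof -
  define p where "p w = (\<lambda>x. if x \<in> S then - w x else 0)" for w :: "'v \<Rightarrow> real"
  have fin: "(\<Sum>\<^sub>\<infinity>x. p w x * g x) = (\<Sum>x\<in>S. - w x * g x)" for w g :: "'v \<Rightarrow> real"
  proof -
    have "(\<Sum>\<^sub>\<infinity>x. p w x * g x) = (\<Sum>\<^sub>\<infinity>x\<in>S. - w x * g x)"
      by (rule infsum_cong_neutral) (auto simp: p_def)
    then show ?thesis using assms(4) by simp
  qed
  have eq: "Q (off S w) - Q w = 2 * (\<Sum>x\<in>S. - w x * L w x) + (\<Sum>x\<in>S. - w x * L (p w) x)"
    if "l2 w" for w
  proof -
    have p: "l2 (p w)" by (rule l2_mono[OF that]) (simp add: p_def)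
    have "off S w = (\<lambda>x. w x + p w x)" by (auto simp: off_def p_def)
    then show ?thesis using Q_add[OF that p] by (simp only: fin Q_eq[OF p])
  qed
  have "(\<lambda>n. p (u n) x) \<longlonglongrightarrow> p v x" for x
    by (auto simp: p_def intro!: tendsto_intros assms)
  then show ?thesis
    unfolding eq[OF assms(1)] eq[OF assms(2)]
    by (intro tendsto_intros L_tendsto assms)
qed

lemma Q_perturb:
  assumes "l2 u"
  shows "Q (\<lambda>y. u y + (if y = x then s else 0)) = Q u + 2 * s * L u x + s\<^sup>2 * Q (\<lambda>y. if y = x then 1 else 0)"
proof -
  have fin: "l2 (\<lambda>y. if y = x then s else 0)" for s :: real
    by (rule l2_finite) (rule finite_subset[of _ "{x}"], auto)
  have "(\<Sum>\<^sub>\<infinity>y. (if y = x then s else 0) * L u y) = (\<Sum>\<^sub>\<infinity>y\<in>{x}. s * L u y)"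
    by (rule infsum_cong_neutral) auto
  moreover have "Q (\<lambda>y. if y = x then s else 0) = s\<^sup>2 * Q (\<lambda>y. if y = x then 1 else 0)"
    unfolding Q_cmult[symmetric] by (rule arg_cong[where f = Q]) auto
  ultimately show ?thesis
    using Q_add[OF assms fin[of s]] by simp
qed

end

section \<open>The Nehari set\<close>

lemma infsum_strict_mono_real:
  fixes g h :: "'a \<Rightarrow> real"
  assumes "g summable_on UNIV" "h summable_on UNIV" "\<And>x. g x \<le> h x" "g y < h y"
  shows "infsum g UNIV < infsum h UNIV"
  by (rule has_sum_strict_mono[OF has_sum_infsum has_sum_infsum]) (use assms in auto)

locale nehari = schroedinger adj D V V0 V1 + nonlinearity f
  for adj :: "'v \<Rightarrow> 'v \<Rightarrow> bool" and D :: nat and V :: "'v \<Rightarrow> real" and V0 V1 :: real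
    and f :: "'v \<Rightarrow> real \<Rightarrow> real"
begin

text \<open>The derivative of the energy at \<open>u\<close> in the direction \<open>u\<close>.\<close>

definition J where "J u = Q u - (\<Sum>\<^sub>\<infinity>x. f x (u x) * u x)"

definition \<Psi> where "\<Psi> u = (\<Sum>\<^sub>\<infinity>x. H x (u x))"

abbreviation \<Phi> where "\<Phi> \<equiv> energy adj V f"

text \<open>The Nehari set: all nonzero critical points of the energy belong to it.\<close>

definition N where "N = {u. l2 u \<and> (\<exists>x. u x \<noteq> 0) \<and> J u = 0}"

text \<open>An upper bound for the form \<open>Q\<close> relative to \<^const>\<open>sq_norm\<close>.\<close>

definition form_bound where "form_bound = 2 * real D + V1"

lemma form_bound_pos: "form_bound > 0"
  using V0 V_ge V_le by (metis form_bound_def add_nonneg_pos mult_nonneg_nonneg of_nat_0_le_iff order_less_le_trans order_trans zero_le_numeral)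

lemma bounded_ratio:
  assumes "l2 u"
  obtains K where "K \<ge> 0" "\<And>x t. \<bar>t\<bar> \<le> T \<Longrightarrow> \<bar>f x (t * u x)\<bar> \<le> K * \<bar>t * u x\<bar>"
proof -
  obtain K where K: "K \<ge> 0" "\<And>x s. \<bar>s\<bar> \<le> T * sqrt (sq_norm u) \<Longrightarrow> \<bar>f x s\<bar> \<le> K * \<bar>s\<bar>"
    using growth by blast
  show thesis
  proof (rule that[OF K(1)])
    fix x t assume "\<bar>t\<bar> \<le> T"
    then show "\<bar>f x (t * u x)\<bar> \<le> K * \<bar>t * u x\<bar>"
      using abs_le_sqrt_sq_norm[OF assms, of x] by (intro K) (auto simp: abs_mult intro: mult_mono)
  qed
qed

lemma fu_summable: 
  assumes "l2 u"
  shows "(\<lambda>x. f x (u x) * u x) summable_on UNIV"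
proof -
  obtain K where K: "K \<ge> 0" "\<And>x t. \<bar>t\<bar> \<le> 1 \<Longrightarrow> \<bar>f x (t * u x)\<bar> \<le> K * \<bar>t * u x\<bar>"
    using bounded_ratio[OF assms] by blast
  show ?thesis
  proof (rule l2_dominated[OF assms])
    show "\<bar>f x (u x) * u x\<bar> \<le> K * (u x)\<^sup>2" for x
      using f_bound[OF K(2)[of 1 x]] f_mult_nonneg[of x "u x"] by simp
  qed
qed

lemma F_summable: "l2 u \<Longrightarrow> (\<lambda>x. F x (u x)) summable_on UNIV"
  by (rule summable_dominated(1)[OF summable_on_cmult_right[OF fu_summable, of u "1/2"]])
    (use F_nonneg F_le in auto)

lemma H_summable:
  assumes "l2 u"
  shows "(\<lambda>x. H x (u x)) summable_on UNIV"
proof -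
  have "(\<lambda>x. 1/2 * (f x (u x) * u x) + - 1 * F x (u x)) summable_on UNIV"
    by (intro summable_on_add summable_on_cmult_right fu_summable F_summable assms)
  then show ?thesis by (simp add: H_def[abs_def])
qed

lemma \<Phi>_def: "\<Phi> u = 1/2 * Q u - (\<Sum>\<^sub>\<infinity>x. F x (u x))"
  by (simp add: energy_def Q_def)

lemma \<Phi>_eq:
  assumes "l2 u"
  shows "\<Phi> u = \<Psi> u + J u / 2"
proof -
  have "\<Psi> u = (\<Sum>\<^sub>\<infinity>x. 1/2 * (f x (u x) * u x) + - 1 * F x (u x))"
    unfolding \<Psi>_def by (rule infsum_cong) (simp add: H_def)
  also have "\<dots> = 1/2 * (\<Sum>\<^sub>\<infinity>x. f x (u x) * u x) + - 1 * (\<Sum>\<^sub>\<infinity>x. F x (u x))"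
    unfolding infsum_cmult_right'[symmetric]
    by (intro infsum_add summable_on_cmult_right fu_summable F_summable assms)
  finally show ?thesis by (simp add: \<Phi>_def J_def field_simps)
qed

lemma \<Psi>_pos: "l2 u \<Longrightarrow> u y \<noteq> 0 \<Longrightarrow> \<Psi> u > 0"
  using infsum_strict_mono_real[of "\<lambda>_. 0" "\<lambda>x. H x (u x)" y] H_summable H_nonneg H_pos
  by (simp add: \<Psi>_def)

lemma \<Psi>_mono:
  assumes "l2 u" "0 \<le> t" "t \<le> 1"
  shows "\<Psi> (\<lambda>x. t * u x) \<le> \<Psi> u"
  unfolding \<Psi>_def using assms by (intro infsum_mono H_summable l2_cmult H_mono)

lemma N_D:
  assumes "u \<in> N"
  shows "l2 u" "J u = 0" "\<Phi> u = \<Psi> u" "\<Phi> u > 0" "Q u = (\<Sum>\<^sub>\<infinity>x. f x (u x) * u x)" "\<exists>x. u x \<noteq> 0"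
proof -
  show u: "l2 u" "J u = 0" "\<exists>x. u x \<noteq> 0" using assms by (auto simp: N_def)
  then show "\<Phi> u = \<Psi> u" by (simp add: \<Phi>_eq)
  then show "\<Phi> u > 0" using \<Psi>_pos u by auto
  show "Q u = (\<Sum>\<^sub>\<infinity>x. f x (u x) * u x)" using u by (simp add: J_def)
qed

lemma J_neg_nonzero: "J u < 0 \<Longrightarrow> \<exists>x. u x \<noteq> 0"
proof (rule ccontr)
  assume "J u < 0" "\<nexists>x. u x \<noteq> 0"
  then have "u = (\<lambda>_. 0)" by auto
  then have "J u = 0" using Q_cmult[of 0 u] by (simp add: J_def)
  then show False using \<open>J u < 0\<close> by simp
qed

text \<open>Where \<open>\<bar>u\<bar>\<close> is small, the nonlinear terms are dominated by half of the lower bound \<open>V0\<close> of the form.\<close>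

lemma small_amplitude:
  obtains d where "d > 0"
    "\<And>u. l2 u \<Longrightarrow> (\<And>x. \<bar>u x\<bar> < d) \<Longrightarrow> V0/2 * sq_norm u \<le> J u \<and> V0/4 * sq_norm u \<le> \<Phi> u"
proof -
  obtain d where d: "d > 0" "\<And>x s. \<bar>s\<bar> < d \<Longrightarrow> \<bar>f x s\<bar> \<le> V0/2 * \<bar>s\<bar>"
    using small[of "V0/2"] V0 by auto
  have "V0/2 * sq_norm u \<le> J u \<and> V0/4 * sq_norm u \<le> \<Phi> u" if u: "l2 u" "\<And>x. \<bar>u x\<bar> < d" for u
  proof -
    have "(\<Sum>\<^sub>\<infinity>x. f x (u x) * u x) \<le> (\<Sum>\<^sub>\<infinity>x. V0/2 * (u x)\<^sup>2)"
      using u(1) f_bound[OF d(2)[OF u(2)]]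
      by (intro infsum_mono fu_summable summable_on_cmult_right) (auto simp: l2_def)
    also have "\<dots> = V0/2 * sq_norm u" by (simp only: infsum_cmult_right' sq_norm_def)
    finally have 1: "(\<Sum>\<^sub>\<infinity>x. f x (u x) * u x) \<le> V0/2 * sq_norm u" .
    have "(\<Sum>\<^sub>\<infinity>x. F x (u x)) \<le> (\<Sum>\<^sub>\<infinity>x. 1/2 * (f x (u x) * u x))"
      using F_le by (intro infsum_mono F_summable summable_on_cmult_right fu_summable u(1)) simp
    also have "\<dots> = 1/2 * (\<Sum>\<^sub>\<infinity>x. f x (u x) * u x)" by (simp only: infsum_cmult_right')
    finally show ?thesis using 1 Q_ge[OF u(1)] by (simp add: J_def \<Phi>_def)
  qed
  then show thesis using that d(1) by blast
qed

lemma nonvanishing: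
  obtains d where "d > 0" "\<And>u. u \<in> N \<Longrightarrow> \<exists>x. \<bar>u x\<bar> \<ge> d"
proof -
  obtain d where d: "d > 0"
    "\<And>u. l2 u \<Longrightarrow> (\<And>x. \<bar>u x\<bar> < d) \<Longrightarrow> V0/2 * sq_norm u \<le> J u \<and> V0/4 * sq_norm u \<le> \<Phi> u"
    using small_amplitude by blast
  have "\<exists>x. \<bar>u x\<bar> \<ge> d" if uN: "u \<in> N" for u
  proof (rule ccontr)
    assume "\<not> ?thesis"
    then have "\<And>x. \<bar>u x\<bar> < d" by (meson not_le)
    then have "V0/2 * sq_norm u \<le> 0" using d(2)[of u] N_D(1,2)[OF uN] by simp
    moreover obtain x where "u x \<noteq> 0" using N_D(6)[OF uN] by blast
    then have "sq_norm u > 0" by (rule sq_norm_pos[OF N_D(1)[OF uN]])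
    ultimately show False using V0 by (simp add: mult_le_0_iff)
  qed
  then show thesis using that d(1) by blast
qed

lemma J_ray_continuous:
  assumes "l2 u"
  shows "continuous_on {-T..T} (\<lambda>t. J (\<lambda>x. t * u x))"
proof -
  obtain K where K: "K \<ge> 0" "\<And>x t. \<bar>t\<bar> \<le> T \<Longrightarrow> \<bar>f x (t * u x)\<bar> \<le> K * \<bar>t * u x\<bar>"
    using bounded_ratio[OF assms] by blast
  have "continuous_on {-T..T} (\<lambda>t. \<Sum>\<^sub>\<infinity>x. f x (t * u x) * (t * u x))"
  proof (rule continuous_on_infsum_param)
    show "(\<lambda>x. K * T\<^sup>2 * (u x)\<^sup>2) summable_on UNIV"
      using assms by (intro summable_on_cmult_right) (simp add: l2_def)
    fix x
    have "continuous_on {-T..T} (\<lambda>t. f x (t * u x))"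
      by (rule continuous_on_compose2[OF cont[of x]]) (auto intro: continuous_intros)
    then show "continuous_on {-T..T} (\<lambda>t. f x (t * u x) * (t * u x))"
      by (intro continuous_intros)
    fix t assume "t \<in> {-T..T}"
    then have t: "\<bar>t\<bar> \<le> T" by auto
    have "f x (t * u x) * (t * u x) \<le> K * (t * u x)\<^sup>2"
      by (rule f_bound) (rule K(2)[OF t])
    also have "\<dots> = K * t\<^sup>2 * (u x)\<^sup>2" by (simp add: power_mult_distrib)
    also have "\<dots> \<le> K * T\<^sup>2 * (u x)\<^sup>2"
      using t K(1) by (intro mult_right_mono mult_left_mono) (auto simp: abs_le_square_iff[symmetric])
    finally show "\<bar>f x (t * u x) * (t * u x)\<bar> \<le> K * T\<^sup>2 * (u x)\<^sup>2"
      using f_mult_nonneg[of x "t * u x"] by simp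
  qed
  then show ?thesis unfolding J_def Q_cmult by (intro continuous_intros)
qed

text \<open>Intermediate value theorem on the segment from \<open>0\<close> to \<open>w\<close>: close to \<open>0\<close> the amplitude is small, so
\<open>J\<close> is nonnegative there.\<close>

lemma descent:
  assumes "l2 w" "w y \<noteq> 0" "J w \<le> 0"
  obtains t where "0 < t" "t \<le> 1" "(\<lambda>x. t * w x) \<in> N"
proof -
  obtain d where d: "d > 0"
    "\<And>u. l2 u \<Longrightarrow> (\<And>x. \<bar>u x\<bar> < d) \<Longrightarrow> V0/2 * sq_norm u \<le> J u \<and> V0/4 * sq_norm u \<le> \<Phi> u"
    using small_amplitude by blast
  define B where "B = sqrt (sq_norm w)"
  have B: "B > 0" "\<And>x. \<bar>w x\<bar> \<le> B"
    using sq_norm_pos[OF assms(1,2)] abs_le_sqrt_sq_norm[OF assms(1)] by (auto simp: B_def)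
  define t0 where "t0 = min 1 (d / (2 * B))"
  have t0: "0 < t0" "t0 \<le> 1" using d(1) B(1) by (auto simp: t0_def)
  have "\<bar>t0 * w x\<bar> < d" for x
  proof -
    have "\<bar>t0 * w x\<bar> \<le> d / (2 * B) * B"
      unfolding abs_mult using t0 B by (intro mult_mono) (auto simp: t0_def)
    then show ?thesis using B(1) d(1) by simp
  qed
  then have "V0/2 * sq_norm (\<lambda>x. t0 * w x) \<le> J (\<lambda>x. t0 * w x)"
    using d(2)[OF l2_cmult[OF assms(1)]] by blast
  moreover have "0 \<le> V0/2 * sq_norm (\<lambda>x. t0 * w x)"
    using V0 by (intro mult_nonneg_nonneg) simp_all
  ultimately have "0 \<le> J (\<lambda>x. t0 * w x)" by linarith
  moreover have "J (\<lambda>x. 1 * w x) \<le> 0" using assms(3) by simp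
  moreover have "continuous_on {t0..1} (\<lambda>t. J (\<lambda>x. t * w x))"
    by (rule continuous_on_subset[OF J_ray_continuous[OF assms(1), of 1]]) (use t0 in auto)
  ultimately obtain t where t: "t0 \<le> t" "t \<le> 1" "J (\<lambda>x. t * w x) = 0"
    using IVT2'[of "\<lambda>t. J (\<lambda>x. t * w x)" 1 0 t0] t0 by auto
  show thesis
    by (rule that[of t]) (use t t0 assms l2_cmult in \<open>auto simp: N_def intro!: exI[of _ y]\<close>)
qed

text \<open>On \<open>N\<close> the energy is \<open>\<Psi>\<close>, and shrinking does not increase \<open>\<Psi>\<close>.\<close>

lemma \<Psi>_lower:
  assumes "l2 w" "w y \<noteq> 0" "J w \<le> 0"
  obtains v where "v \<in> N" "\<Phi> v \<le> \<Psi> w"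
proof -
  obtain t where t: "0 < t" "t \<le> 1" "(\<lambda>x. t * w x) \<in> N" using descent[OF assms] .
  show thesis
    by (rule that[OF t(3)]) (use N_D(3)[OF t(3)] \<Psi>_mono[OF assms(1), of t] t in auto)
qed

lemma J_ray:
  assumes "u \<in> N"
  shows "0 < t \<Longrightarrow> t < 1 \<Longrightarrow> J (\<lambda>x. t * u x) > 0" "t > 1 \<Longrightarrow> J (\<lambda>x. t * u x) < 0"
proof -
  note u = N_D[OF assms]
  obtain y where y: "u y \<noteq> 0" using u(6) by blast
  have eq: "t\<^sup>2 * Q u = (\<Sum>\<^sub>\<infinity>x. t\<^sup>2 * (f x (u x) * u x))"
    by (simp only: u(5) infsum_cmult_right')
  have s1: "(\<lambda>x. t\<^sup>2 * (f x (u x) * u x)) summable_on UNIV"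
    by (intro summable_on_cmult_right fu_summable u)
  have s2: "(\<lambda>x. f x (t * u x) * (t * u x)) summable_on UNIV"
    by (rule fu_summable) (rule l2_cmult[OF u(1)])
  have sq: "t\<^sup>2 * (f x (u x) * u x) = t * (t * (f x (u x) * u x))"
    "f x (t * u x) * (t * u x) = t * (f x (t * u x) * u x)" for x
    by (simp_all add: power2_eq_square)
  show "J (\<lambda>x. t * u x) > 0" if "0 < t" "t < 1"
    using infsum_strict_mono_real[OF s2 s1, of y] f_ray[where t = t] that y
    unfolding J_def Q_cmult eq sq by (simp add: mult_left_mono)
  show "J (\<lambda>x. t * u x) < 0" if "t > 1"
    using infsum_strict_mono_real[OF s1 s2, of y] f_ray_ge[where t = t] that y
    unfolding J_def Q_cmult eq sq by (simp add: mult_left_mono)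
qed

text \<open>\<open>F_ray\<close> at every vertex; the quadratic part and the tangent terms cancel because \<open>J u = 0\<close>.\<close>

lemma ray_max:
  assumes "u \<in> N" "t \<ge> 0"
  shows "\<Phi> (\<lambda>x. t * u x) \<le> \<Phi> u"
proof -
  note u = N_D[OF assms(1)]
  have "(\<Sum>\<^sub>\<infinity>x. F x (u x)) + (t\<^sup>2 - 1) / 2 * (\<Sum>\<^sub>\<infinity>x. f x (u x) * u x)
      = (\<Sum>\<^sub>\<infinity>x. F x (u x) + (t\<^sup>2 - 1) / 2 * (f x (u x) * u x))"
    unfolding infsum_cmult_right'[symmetric]
    by (rule infsum_add[symmetric]) (intro summable_on_cmult_right fu_summable F_summable u)+
  also have "\<dots> \<le> (\<Sum>\<^sub>\<infinity>x. F x (t * u x))"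
  proof (intro infsum_mono summable_on_add summable_on_cmult_right fu_summable F_summable u l2_cmult)
    fix x
    have "f x (u x) * u x / 2 * (t\<^sup>2 - 1) = (t\<^sup>2 - 1) / 2 * (f x (u x) * u x)" by simp
    then show "F x (u x) + (t\<^sup>2 - 1) / 2 * (f x (u x) * u x) \<le> F x (t * u x)"
      using F_ray[OF assms(2), of x "u x"] by linarith
  qed
  finally show ?thesis
    unfolding \<Phi>_def Q_cmult u(5) by (simp add: field_simps)
qed

lemma \<Phi>_le_point:
  assumes "l2 u"
  shows "\<Phi> u \<le> form_bound / 2 * sq_norm u - F x (u x)"
proof -
  have "F x (u x) \<le> (\<Sum>\<^sub>\<infinity>x. F x (u x))"
    using finite_sum_le_infsum[OF F_summable[OF assms], of "{x}"] F_nonneg by simp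
  then show ?thesis using Q_le[OF assms] by (simp add: \<Phi>_def form_bound_def)
qed

text \<open>Scale \<open>u\<close> to \<open>\<ell>\<^sup>2\<close> norm \<open>s\<close>, with \<open>s\<close> so large that a function of this norm and small amplitude
would have energy above \<open>C\<close>.  As \<open>u\<close> maximizes the energy on its ray, the scaled function has energy at most
\<open>C\<close>, hence a value of size at least \<open>d\<close> at some vertex \<open>x\<close>.  So \<open>\<bar>u x\<bar>\<close> is at least a fixed fraction of the norm
of \<open>u\<close>, and if it were beyond the threshold \<open>R\<close> then the superquadratic term at \<open>x\<close> alone would make
the energy negative.\<close>

lemma sublevel_bounded:
  obtains M where "\<And>u. u \<in> N \<Longrightarrow> \<Phi> u \<le> C \<Longrightarrow> sq_norm u \<le> M"
proof -
  obtain d where d: "d > 0"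
    "\<And>u. l2 u \<Longrightarrow> (\<And>x. \<bar>u x\<bar> < d) \<Longrightarrow> V0/2 * sq_norm u \<le> J u \<and> V0/4 * sq_norm u \<le> \<Phi> u"
    using small_amplitude by blast
  \<comment> \<open>chosen so that the energy bound \<open>V0 / 4 * s\<^sup>2\<close> at small amplitude is \<open>\<bar>C\<bar> + 1\<close>\<close>
  define s where "s = sqrt (4 * (\<bar>C\<bar> + 1) / V0)"
  have "s > 0" using V0 by (simp add: s_def)
  moreover have "s\<^sup>2 = 4 * (\<bar>C\<bar> + 1) / V0" using V0 by (simp add: s_def)
  then have "V0/4 * s\<^sup>2 = \<bar>C\<bar> + 1" using V0 by simp
  ultimately have s: "s > 0" "V0/4 * s\<^sup>2 > C" by linarith+
  obtain R where R: "R > 0" "\<And>x r. \<bar>r\<bar> \<ge> R \<Longrightarrow> F x r \<ge> form_bound * s\<^sup>2 / d\<^sup>2 * r\<^sup>2"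
    using superquadratic by blast
  have "sq_norm u \<le> (R * s / d)\<^sup>2" if uN: "u \<in> N" and uC: "\<Phi> u \<le> C" for u
  proof -
    note u = N_D[OF uN]
    define B where "B = sqrt (sq_norm u)"
    have B: "B > 0" "sq_norm u = B\<^sup>2" using sq_norm_pos[OF u(1)] u(6) by (auto simp: B_def)
    define v where "v = (\<lambda>x. s / B * u x)"
    have v: "l2 v" unfolding v_def by (rule l2_cmult[OF u(1)])
    have "sq_norm v = s\<^sup>2" unfolding v_def sq_norm_cmult B(2) using B(1) by (simp add: power_divide)
    moreover have "\<Phi> v \<le> C"
      using ray_max[OF uN, of "s / B"] uC s(1) B(1) by (simp add: v_def)
    ultimately have "\<not> (V0/4 * sq_norm v \<le> \<Phi> v)" using s(2) by simp
    then obtain x where "\<bar>v x\<bar> \<ge> d" using d(2)[OF v] by (meson not_le)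
    then have x: "d * B / s \<le> \<bar>u x\<bar>" using s(1) B(1) by (simp add: v_def abs_mult field_simps)
    have "\<bar>u x\<bar> < R"
    proof (rule ccontr)
      assume "\<not> ?thesis"
      then have "F x (u x) \<ge> form_bound * s\<^sup>2 / d\<^sup>2 * (u x)\<^sup>2" by (intro R(2)) simp
      moreover have "(u x)\<^sup>2 \<ge> (d * B / s)\<^sup>2"
        using power_mono[OF x, of 2] d(1) s(1) B(1) by simp
      then have "form_bound * s\<^sup>2 / d\<^sup>2 * (u x)\<^sup>2 \<ge> form_bound * s\<^sup>2 / d\<^sup>2 * (d * B / s)\<^sup>2"
        using form_bound_pos by (intro mult_left_mono) auto
      moreover have "form_bound * s\<^sup>2 / d\<^sup>2 * (d * B / s)\<^sup>2 = form_bound * B\<^sup>2"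
        using d(1) s(1) by (simp add: power_divide power_mult_distrib)
      ultimately have "\<Phi> u \<le> - form_bound / 2 * B\<^sup>2" using \<Phi>_le_point[OF u(1), of x] B(2) by simp
      moreover have "form_bound * B\<^sup>2 > 0" using form_bound_pos B(1) by simp
      ultimately show False using u(4) by simp
    qed
    then have "d * B / s \<le> R" using x by linarith
    then have "B \<le> R * s / d" using s(1) d(1) by (simp add: field_simps)
    then show ?thesis unfolding B(2) using B(1) by (intro power_mono) auto
  qed
  then show thesis using that by blast
qed

text \<open>The factor \<open>T\<close> is uniform: a value of size at least \<open>d\<close> at a single vertex is enough for the
superquadratic term there to beat the whole quadratic form, whose size is controlled by \<open>M\<close>.\<close>

lemma rise:
  assumes "d > 0"
  obtains T where "T > 0" "\<And>u y. l2 u \<Longrightarrow> sq_norm u \<le> M \<Longrightarrow> \<bar>u y\<bar> \<ge> d \<Longrightarrow> J (\<lambda>x. T * u x) \<le> 0"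
proof -
  obtain R where R: "R > 0" "\<And>x r. \<bar>r\<bar> \<ge> R \<Longrightarrow> F x r \<ge> form_bound * \<bar>M\<bar> / d\<^sup>2 * r\<^sup>2"
    using superquadratic by blast
  define T where "T = R / d"
  have T: "T > 0" using R(1) assms by (simp add: T_def)
  have "J (\<lambda>x. T * u x) \<le> 0" if u: "l2 u" "sq_norm u \<le> M" "\<bar>u y\<bar> \<ge> d" for u y
  proof -
    have RT: "R \<le> \<bar>T * u y\<bar>" using mult_left_mono[OF u(3), of T] T R(1) assms by (simp add: T_def abs_mult)
    have "(T * d)\<^sup>2 \<le> (T * u y)\<^sup>2"
      using u(3) T assms unfolding power_mult_distrib
      by (intro mult_left_mono) (auto simp: abs_le_square_iff[symmetric])
    then have "form_bound * \<bar>M\<bar> / d\<^sup>2 * (T * d)\<^sup>2 \<le> form_bound * \<bar>M\<bar> / d\<^sup>2 * (T * u y)\<^sup>2"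
      using form_bound_pos by (intro mult_left_mono) auto
    also have "\<dots> \<le> F y (T * u y)" by (rule R(2)[OF RT])
    also have "form_bound * \<bar>M\<bar> / d\<^sup>2 * (T * d)\<^sup>2 = form_bound * \<bar>M\<bar> * T\<^sup>2"
      using assms by (simp add: power_mult_distrib)
    finally have "form_bound * \<bar>M\<bar> * T\<^sup>2 \<le> F y (T * u y)" .
    moreover have "f y (T * u y) * (T * u y) \<le> (\<Sum>\<^sub>\<infinity>x. f x (T * u x) * (T * u x))"
      using finite_sum_le_infsum[OF fu_summable[OF l2_cmult[OF u(1)]], of "{y}" T] f_mult_nonneg by simp
    moreover have "F y (T * u y) \<le> f y (T * u y) * (T * u y) / 2" by (rule F_le)
    moreover have "Q (\<lambda>x. T * u x) \<le> form_bound * \<bar>M\<bar> * T\<^sup>2"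
    proof -
      have "Q u \<le> form_bound * \<bar>M\<bar>"
      proof -
        have "Q u \<le> form_bound * sq_norm u" using Q_le[OF u(1)] by (simp add: form_bound_def)
        also have "\<dots> \<le> form_bound * \<bar>M\<bar>" using u(2) form_bound_pos by (intro mult_left_mono) auto
        finally show ?thesis .
      qed
      then show ?thesis unfolding Q_cmult by (metis mult.commute mult_left_mono zero_le_power2)
    qed
    moreover have "0 \<le> form_bound * \<bar>M\<bar> * T\<^sup>2" using form_bound_pos by simp
    ultimately show ?thesis unfolding J_def by linarith
  qed
  then show thesis using that T by blast
qed

lemma N_nonempty: "N \<noteq> {}"
proof -
  fix y :: 'v
  define u where "u = (\<lambda>x. if x = y then 1 else 0 :: real)"
  have u: "l2 u" by (rule l2_finite) (simp add: u_def)
  obtain T where T: "T > 0" "\<And>w y. l2 w \<Longrightarrow> sq_norm w \<le> sq_norm u \<Longrightarrow> \<bar>w y\<bar> \<ge> 1 \<Longrightarrow> J (\<lambda>x. T * w x) \<le> 0"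
    using rise[of 1] by (metis zero_less_one)
  have "J (\<lambda>x. T * u x) \<le> 0" by (rule T(2)[of u y]) (use u in \<open>auto simp: u_def\<close>)
  moreover have "T * u y \<noteq> 0" using T(1) by (simp add: u_def)
  ultimately obtain t where "(\<lambda>x. t * (T * u x)) \<in> N"
    using descent[OF l2_cmult[OF u]] by metis
  then show ?thesis by blast
qed

section \<open>Minimizing sequences with nonzero pointwise limit\<close>

lemma minimizing_sequence:
  obtains u where "\<And>n. u n \<in> N" "(\<lambda>n. \<Phi> (u n)) \<longlonglongrightarrow> Inf (\<Phi> ` N)"
    and "\<And>w. w \<in> N \<Longrightarrow> Inf (\<Phi> ` N) \<le> \<Phi> w"
proof -
  have bdd: "bdd_below (\<Phi> ` N)" by (rule bdd_belowI[of _ 0]) (use N_D(4) in force)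
  have low: "\<And>w. w \<in> N \<Longrightarrow> Inf (\<Phi> ` N) \<le> \<Phi> w" using bdd by (simp add: cINF_lower)
  have "\<exists>w\<in>N. \<Phi> w < Inf (\<Phi> ` N) + 1 / real (Suc n)" for n
    using cInf_lessD[of "\<Phi> ` N" "Inf (\<Phi> ` N) + 1 / real (Suc n)"] N_nonempty by auto
  then obtain u where u: "\<And>n. u n \<in> N" "\<And>n. \<Phi> (u n) < Inf (\<Phi> ` N) + 1 / real (Suc n)" by metis
  have "(\<lambda>n. \<Phi> (u n)) \<longlonglongrightarrow> Inf (\<Phi> ` N)"
  proof (rule tendsto_sandwich[OF _ _ tendsto_const])
    show "(\<lambda>n. Inf (\<Phi> ` N) + 1 / real (Suc n)) \<longlonglongrightarrow> Inf (\<Phi> ` N)"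
      using LIMSEQ_inverse_real_of_nat_add[of "Inf (\<Phi> ` N)"] by (simp add: inverse_eq_divide)
    show "\<forall>\<^sub>F n in sequentially. Inf (\<Phi> ` N) \<le> \<Phi> (u n)"
      by (intro always_eventually allI low u(1))
    show "\<forall>\<^sub>F n in sequentially. \<Phi> (u n) \<le> Inf (\<Phi> ` N) + 1 / real (Suc n)"
      by (intro always_eventually allI less_imp_le u(2))
  qed
  then show thesis using that u low by blast
qed

lemma H_tendsto:
  assumes "a \<longlonglongrightarrow> b"
  shows "(\<lambda>n. H x (a n)) \<longlonglongrightarrow> H x b" "(\<lambda>n. f x (a n) * a n) \<longlonglongrightarrow> f x b * b"
proof -
  have "(\<lambda>n. f x (a n)) \<longlonglongrightarrow> f x b"
    by (rule isCont_tendsto_compose[OF _ assms]) (use cont[of x] continuous_on_eq_continuous_at open_UNIV in blast)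
  moreover have "(\<lambda>n. F x (a n)) \<longlonglongrightarrow> F x b"
    by (rule isCont_tendsto_compose[OF _ assms]) (rule DERIV_isCont[OF F_deriv])
  ultimately show "(\<lambda>n. H x (a n)) \<longlonglongrightarrow> H x b" "(\<lambda>n. f x (a n) * a n) \<longlonglongrightarrow> f x b * b"
    unfolding H_def by (intro tendsto_intros assms | simp)+
qed

text \<open>The compactness step.  If \<open>J v \<le> 0\<close>, shrinking \<open>v\<close> and Fatou suffice.  Otherwise the limit takes
too much of \<open>J\<close>: what remains of \<open>u n\<close> off a large finite set \<open>T\<close> has negative \<open>J\<close>, so its \<open>\<Psi>\<close> is at
least \<open>c\<close>, although it falls short of \<open>\<Phi> (u n)\<close> by the sum of \<open>H x (u n x)\<close> over \<open>T\<close>, which tends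
to a positive number.\<close>

lemma attained:
  assumes uN: "\<And>n. u n \<in> N" and lim: "(\<lambda>n. \<Phi> (u n)) \<longlonglongrightarrow> c"
    and low: "\<And>w. w \<in> N \<Longrightarrow> c \<le> \<Phi> w"
    and v: "l2 v" "\<And>x. (\<lambda>n. u n x) \<longlonglongrightarrow> v x" "v y \<noteq> 0"
  obtains w where "w \<in> N" "\<Phi> w \<le> c"
proof (cases "J v \<le> 0")
  case True
  then obtain w where w: "w \<in> N" "\<Phi> w \<le> \<Psi> v" using \<Psi>_lower v by blast
  have "\<Psi> v \<le> c" unfolding \<Psi>_def
  proof (rule fatou(2)[where g = "\<lambda>n x. H x (u n x)", OF _ _ _ lim])
    show "(\<Sum>\<^sub>\<infinity>x. H x (u n x)) \<le> \<Phi> (u n)" for n using N_D(3)[OF uN] by (simp add: \<Psi>_def)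
  qed (use H_nonneg H_summable N_D(1)[OF uN] H_tendsto v in auto)
  then show thesis using that w by force
next
  case False
  obtain S where S: "finite S" "\<And>T. finite T \<Longrightarrow> S \<subseteq> T \<Longrightarrow> sq_norm (off T v) \<le> J v / (2 * form_bound)"
    using small_tail[OF v(1), of "J v / (2 * form_bound)"] False form_bound_pos by auto
  \<comment> \<open>including \<open>y\<close> makes the sum of \<open>H x (v x)\<close> over \<open>T\<close> positive\<close>
  define T where "T = insert y S"
  have T: "finite T" "sq_norm (off T v) \<le> J v / (2 * form_bound)" "y \<in> T"
    using S by (auto simp: T_def)
  have split: "(\<Sum>\<^sub>\<infinity>x. G x (off T w x)) = (\<Sum>\<^sub>\<infinity>x. G x (w x)) - (\<Sum>x\<in>T. G x (w x))"
    if "(\<lambda>x. G x (w x)) summable_on UNIV" "\<And>x. G x 0 = 0" for G :: "'v \<Rightarrow> real \<Rightarrow> real" and w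
  proof -
    have "(\<lambda>x. G x (off T w x)) = off T (\<lambda>x. G x (w x))" using that(2) by (auto simp: off_def)
    then show ?thesis using infsum_split[OF that(1) T(1)] by simp
  qed
  have Joff: "J (off T w) = (Q (off T w) - Q w) + J w + (\<Sum>x\<in>T. f x (w x) * w x)" if "l2 w" for w
    using split[of "\<lambda>x s. f x s * s" w] fu_summable[OF that] by (simp add: J_def)
  have "J (off T v) \<le> form_bound * sq_norm (off T v)"
  proof -
    have "0 \<le> (\<Sum>\<^sub>\<infinity>x. f x (off T v x) * off T v x)" by (rule infsum_nonneg) (rule f_mult_nonneg)
    then show ?thesis using Q_le[OF l2_off[OF v(1)], of T] by (simp add: J_def form_bound_def)
  qed
  also have "\<dots> \<le> form_bound * (J v / (2 * form_bound))" using T(2) form_bound_pos by (intro mult_left_mono) auto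
  also have "\<dots> < J v" using form_bound_pos False by simp
  finally have neg: "J (off T v) - J v < 0" by simp
  have "(\<lambda>n. J (off T (u n))) \<longlonglongrightarrow> (Q (off T v) - Q v) + 0 + (\<Sum>x\<in>T. f x (v x) * v x)"
    unfolding Joff[OF N_D(1)[OF uN]] N_D(2)[OF uN]
    by (intro tendsto_add tendsto_const tendsto_sum Q_off_tendsto H_tendsto v T N_D(1)[OF uN])
  also have "(Q (off T v) - Q v) + 0 + (\<Sum>x\<in>T. f x (v x) * v x) = J (off T v) - J v"
    using Joff[OF v(1)] by simp
  finally have ev: "\<forall>\<^sub>F n in sequentially. J (off T (u n)) < 0"
    using neg by (rule order_tendstoD)
  have "c \<le> c - (\<Sum>x\<in>T. H x (v x))"
  proof (rule tendsto_lowerbound)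
    show "(\<lambda>n. \<Phi> (u n) - (\<Sum>x\<in>T. H x (u n x))) \<longlonglongrightarrow> c - (\<Sum>x\<in>T. H x (v x))"
      by (intro tendsto_intros lim H_tendsto v)
    show "\<forall>\<^sub>F n in sequentially. c \<le> \<Phi> (u n) - (\<Sum>x\<in>T. H x (u n x))"
      using ev
    proof eventually_elim
      case (elim n)
      note un = N_D[OF uN[of n]]
      obtain z where "off T (u n) z \<noteq> 0" using J_neg_nonzero[OF elim] by blast
      then obtain w where "w \<in> N" "\<Phi> w \<le> \<Psi> (off T (u n))"
        using \<Psi>_lower[OF l2_off[OF un(1)]] elim less_imp_le by metis
      then have "c \<le> \<Psi> (off T (u n))" using low by force
      also have "\<dots> = \<Phi> (u n) - (\<Sum>x\<in>T. H x (u n x))"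
        unfolding un(3) unfolding \<Psi>_def by (rule split[of H "u n", OF H_summable[OF un(1)]]) (simp add: H_def)
      finally show ?case .
    qed
  qed simp
  moreover have "(\<Sum>x\<in>T. H x (v x)) > 0"
    by (rule sum_pos2[OF T(1) T(3)]) (use H_pos v H_nonneg in auto)
  ultimately show thesis by simp
qed

end

context nehari begin

section \<open>Minimizers are critical points\<close>

lemma infsum_perturb:
  fixes G :: "'v \<Rightarrow> real \<Rightarrow> real"
  assumes "(\<lambda>y. G y (t * (u y + (if y = x then s else 0)))) summable_on UNIV"
  shows "(\<Sum>\<^sub>\<infinity>y. G y (t * (u y + (if y = x then s else 0))))
    = G x (t * (u x + s)) + (\<Sum>\<^sub>\<infinity>y. off {x} (\<lambda>y. G y (t * u y)) y)"
proof -
  have "off {x} (\<lambda>y. G y (t * (u y + (if y = x then s else 0)))) = off {x} (\<lambda>y. G y (t * u y))"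
    by (auto simp: off_def)
  then show ?thesis using infsum_split[OF assms, of "{x}"] by simp
qed

lemma f_isCont: "isCont (f x) s"
  using cont[of x] continuous_on_eq_continuous_at open_UNIV by blast

text \<open>If the equation failed at \<open>x\<close>, moving \<open>u\<close> at this single vertex in the direction \<open>\<sigma>\<close> of decreasing
energy would lower \<open>\<Phi> (t u)\<close> for all \<open>t\<close> near \<open>1\<close> at once.  The sign change of \<open>J\<close> along the ray
persists under the perturbation, so the perturbed ray still meets \<open>N\<close> near \<open>t = 1\<close>, at a point with
less energy than the maximum \<open>\<Phi> u\<close> along the ray through \<open>u\<close>.\<close>

lemma minimizer_solves:
  assumes uN: "u \<in> N" and min: "\<And>w. w \<in> N \<Longrightarrow> \<Phi> u \<le> \<Phi> w"
  shows "L u x = f x (u x)"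
proof (rule ccontr)
  assume neq: "L u x \<noteq> f x (u x)"
  note u = N_D[OF uN]
  define \<sigma> where "\<sigma> = (if L u x < f x (u x) then 1 else - 1 :: real)"
  have \<sigma>: "\<sigma> * L u x < \<sigma> * f x (u x)" "\<sigma> * \<sigma> = 1" using neq by (auto simp: \<sigma>_def)
  define q where "q = Q (\<lambda>y. if y = x then 1 else 0)"
  define w where "w = (\<lambda>s y. u y + (if y = x then \<sigma> * s else 0))"
  have w: "l2 (w s)" for s
    unfolding w_def by (rule l2_add[OF u(1)]) (rule l2_finite, rule finite_subset[of _ "{x}"], auto)
  have Qw: "Q (w s) = Q u + 2 * (\<sigma> * s) * L u x + s\<^sup>2 * q" for s
  proof -
    have "(\<sigma> * s)\<^sup>2 = s\<^sup>2" using \<sigma>(2) by (simp add: power_mult_distrib power2_eq_square)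
    then show ?thesis using Q_perturb[OF u(1), of x "\<sigma> * s"] by (simp add: w_def q_def)
  qed
  \<comment> \<open>\<open>P (t, s)\<close> is the derivative of \<open>\<Phi> (\<lambda>y. t * w s y)\<close> in \<open>s\<close>; at \<open>(1, 0)\<close> it is \<open>\<sigma> * (L u x - f x (u x))\<close>\<close>
  define P where "P = (\<lambda>(t, s). t\<^sup>2 * \<sigma> * L u x + t\<^sup>2 * s * q - f x (t * (u x + \<sigma> * s)) * (t * \<sigma>))"
  have "continuous_on UNIV P"
    unfolding P_def case_prod_unfold
    by (intro continuous_intros continuous_on_compose2[OF cont[of x]]) auto
  then have "open {p. P p < 0}"
    by (intro open_Collect_less continuous_intros)
  moreover have "(1, 0) \<in> {p. P p < 0}" using \<sigma>(1) by (simp add: P_def mult.commute)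
  ultimately obtain A B where AB: "open A" "open B" "(1, 0) \<in> A \<times> B" "A \<times> B \<subseteq> {p. P p < 0}"
    using open_prod_elim by blast
  obtain r1 where r1: "r1 > 0" "ball 1 r1 \<subseteq> A" using AB openE by blast
  obtain r2 where r2: "r2 > 0" "ball 0 r2 \<subseteq> B" using AB openE by blast
  have P: "P (t, s) < 0" if "\<bar>t - 1\<bar> < r1" "\<bar>s\<bar> < r2" for t s
    using AB(4) r1(2) r2(2) that by (force simp: dist_real_def abs_minus_commute)
  define \<rho> where "\<rho> = min 1 r1 / 2"
  have \<rho>: "0 < \<rho>" "\<rho> < 1" "\<rho> < r1" using r1(1) by (auto simp: \<rho>_def)
  have J: "J (\<lambda>y. t * w s y) = t\<^sup>2 * (Q u + 2 * (\<sigma> * s) * L u x + s\<^sup>2 * q)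
      - (f x (t * (u x + \<sigma> * s)) * (t * (u x + \<sigma> * s))
        + (\<Sum>\<^sub>\<infinity>y. off {x} (\<lambda>y. f y (t * u y) * (t * u y)) y))" for t s
    unfolding J_def Q_cmult Qw
    using infsum_perturb[of "\<lambda>y r. f y r * r" t u x "\<sigma> * s"] fu_summable[OF l2_cmult[OF w[of s]], of t]
    by (simp add: w_def)
  have \<Phi>w: "\<Phi> (\<lambda>y. t * w s y) = 1/2 * (t\<^sup>2 * (Q u + 2 * (\<sigma> * s) * L u x + s\<^sup>2 * q))
      - (F x (t * (u x + \<sigma> * s)) + (\<Sum>\<^sub>\<infinity>y. off {x} (\<lambda>y. F y (t * u y)) y))" for t s
    unfolding \<Phi>_def Q_cmult Qw
    using infsum_perturb[of F t u x "\<sigma> * s"] F_summable[OF l2_cmult[OF w[of s]], of t]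
    by (simp add: w_def)
  have w0: "w 0 = u" by (auto simp: w_def)
  have contJ: "((\<lambda>s. J (\<lambda>y. t * w s y)) \<longlongrightarrow> J (\<lambda>y. t * u y)) (at_right 0)" for t
  proof -
    have "isCont (\<lambda>s. J (\<lambda>y. t * w s y)) 0"
      unfolding J by (intro continuous_intros isCont_o2[OF _ f_isCont])
    then show ?thesis unfolding isCont_def w0 by (rule tendsto_within_subset) simp
  qed
  have "\<forall>\<^sub>F s in at_right 0. J (\<lambda>y. (1 - \<rho>) * w s y) > 0"
    by (rule order_tendstoD(1)[OF contJ]) (rule J_ray[OF uN], use \<rho> in auto)
  moreover have "\<forall>\<^sub>F s in at_right 0. J (\<lambda>y. (1 + \<rho>) * w s y) < 0"
    by (rule order_tendstoD(2)[OF contJ]) (rule J_ray[OF uN], use \<rho> in auto)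
  moreover have "\<forall>\<^sub>F s in at_right 0. s \<in> {0<..<r2}"
    by (rule eventually_at_right_real) (rule r2)
  ultimately have "\<forall>\<^sub>F s in at_right 0. J (\<lambda>y. (1 - \<rho>) * w s y) > 0 \<and> J (\<lambda>y. (1 + \<rho>) * w s y) < 0 \<and> s \<in> {0<..<r2}"
    by (intro eventually_conj)
  then obtain s where s: "J (\<lambda>y. (1 - \<rho>) * w s y) > 0" "J (\<lambda>y. (1 + \<rho>) * w s y) < 0" "0 < s" "s < r2"
    using eventually_happens by fastforce
  have "continuous_on {1 - \<rho>..1 + \<rho>} (\<lambda>t. J (\<lambda>y. t * w s y))"
    by (rule continuous_on_subset[OF J_ray_continuous[OF w, of 2]]) (use \<rho> in auto)
  then obtain t where t: "1 - \<rho> \<le> t" "t \<le> 1 + \<rho>" "J (\<lambda>y. t * w s y) = 0"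
    using IVT2'[of "\<lambda>t. J (\<lambda>y. t * w s y)" "1 + \<rho>" 0 "1 - \<rho>"] s \<rho> by auto
  obtain z where "(1 + \<rho>) * w s z \<noteq> 0" using J_neg_nonzero[OF s(2)] by blast
  then have "(\<lambda>y. t * w s y) \<in> N"
    using t \<rho> l2_cmult[OF w] by (auto simp: N_def intro!: exI[of _ z])
  then have "\<Phi> u \<le> \<Phi> (\<lambda>y. t * w s y)" by (rule min)
  also have "\<dots> < \<Phi> (\<lambda>y. t * w 0 y)"
  proof (rule DERIV_neg_imp_decreasing[OF s(3)])
    fix r assume r: "0 \<le> r" "r \<le> s"
    have "((\<lambda>s. \<Phi> (\<lambda>y. t * w s y)) has_real_derivative P (t, r)) (at r)"
      unfolding \<Phi>w
      by (rule derivative_eq_intros DERIV_chain2[OF F_deriv] refl)+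
        (simp add: P_def algebra_simps power2_eq_square)
    moreover have "P (t, r) < 0" by (rule P) (use r t s \<rho> in \<open>auto simp: abs_if\<close>)
    ultimately show "\<exists>y. ((\<lambda>s. \<Phi> (\<lambda>y. t * w s y)) has_real_derivative y) (at r) \<and> y < 0" by blast
  qed
  also have "\<dots> \<le> \<Phi> u" unfolding w0 by (rule ray_max[OF uN]) (use t \<rho> in auto)
  finally show False by simp
qed

lemma remainder_mvt:
  obtains \<xi> where "\<bar>\<xi> - a\<bar> \<le> \<bar>b\<bar>" "F x (a + b) - F x a = b * f x \<xi>"
proof (cases "b = 0")
  case True
  then show thesis using that[of a] by simp
next
  case False
  consider "b > 0" | "b < 0" using False by linarith
  then show thesis
  proof cases
    case 1
    obtain \<xi> where "a < \<xi>" "\<xi> < a + b" "F x (a + b) - F x a = (a + b - a) * f x \<xi>"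
      using MVT2[of a "a + b" "F x" "f x"] F_deriv 1 by auto
    then show thesis using that[of \<xi>] by auto
  next
    case 2
    obtain \<xi> where "a + b < \<xi>" "\<xi> < a" "F x a - F x (a + b) = (a - (a + b)) * f x \<xi>"
      using MVT2[of "a + b" a "F x" "f x"] F_deriv 2 by auto
    then show thesis using that[of \<xi>] by auto
  qed
qed

lemma l2_fu:
  assumes "l2 u"
  shows "l2 (\<lambda>x. f x (u x))"
proof -
  obtain K where K: "K \<ge> 0" "\<And>x t. \<bar>t\<bar> \<le> 1 \<Longrightarrow> \<bar>f x (t * u x)\<bar> \<le> K * \<bar>t * u x\<bar>"
    using bounded_ratio[OF assms] by blast
  show ?thesis
  proof (rule l2_mono[OF l2_cmult[OF assms, of K]])
    show "\<bar>f x (u x)\<bar> \<le> \<bar>K * u x\<bar>" for x using K(2)[of 1 x] K(1) by (simp add: abs_mult)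
  qed
qed

text \<open>The form contributes a term of order \<open>\<parallel>h\<parallel>\<^sup>2\<close>.  For the nonlinear part the mean value theorem is used at
every vertex: on a finite set \<open>S\<close> continuity of \<open>f x\<close> makes the remainder small, and off \<open>S\<close> it is at
most a constant times \<open>\<bar>u x\<bar> \<bar>h x\<bar> + (h x)\<^sup>2\<close>, which Cauchy-Schwarz controls by the small tail of \<open>u\<close>.\<close>

lemma frechet_derivative:
  assumes u: "l2 u" and e: "e > 0"
  obtains \<delta> where "\<delta> > 0" "\<And>h. l2 h \<Longrightarrow> sqrt (sq_norm h) < \<delta> \<Longrightarrow>
    \<bar>\<Phi> (\<lambda>x. u x + h x) - \<Phi> u - (\<Sum>\<^sub>\<infinity>x. h x * (L u x - f x (u x)))\<bar> \<le> e * sqrt (sq_norm h)"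
proof -
  obtain K where K: "K \<ge> 0" "\<And>x s. \<bar>s\<bar> \<le> sqrt (sq_norm u) + 1 \<Longrightarrow> \<bar>f x s\<bar> \<le> K * \<bar>s\<bar>"
    using growth by blast
  obtain S where S: "finite S" "sq_norm (off S u) \<le> (e / (8 * (K + 1)))\<^sup>2"
    using small_tail[OF u, of "(e / (8 * (K + 1)))\<^sup>2"] e K(1) by (metis add_nonneg_pos divide_pos_pos mult_pos_pos order_refl zero_less_numeral zero_less_one zero_less_power)
  define \<eta> where "\<eta> = e / (4 * (real (card S) + 1))"
  have \<eta>: "\<eta> > 0" using e by (simp add: \<eta>_def)
  have "\<exists>d>0. \<forall>\<xi>. \<bar>\<xi> - u x\<bar> < d \<longrightarrow> \<bar>f x \<xi> - f x (u x)\<bar> < \<eta>" for x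
    using f_isCont[where x = x and s = "u x"] \<eta> unfolding continuous_at_eps_delta dist_real_def by metis
  then obtain d where d: "\<And>x. d x > 0" "\<And>x \<xi>. \<bar>\<xi> - u x\<bar> < d x \<Longrightarrow> \<bar>f x \<xi> - f x (u x)\<bar> < \<eta>" by metis
  define d0 where "d0 = Min (insert 1 (d ` S))"
  have d0: "d0 > 0" "d0 \<le> 1" "\<And>x. x \<in> S \<Longrightarrow> d0 \<le> d x"
    using S(1) d(1) by (auto simp: d0_def)
  define C where "C = 2 * K + form_bound / 2"
  have C: "C > 0" using K(1) form_bound_pos by (simp add: C_def)
  define \<delta> where "\<delta> = min d0 (e / (4 * C))"
  have \<delta>: "\<delta> > 0" "\<delta> \<le> d0" "\<delta> \<le> e / (4 * C)" using d0 e C by (auto simp: \<delta>_def)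
  show thesis
  proof (rule that[OF \<delta>(1)])
    fix h :: "'v \<Rightarrow> real" assume h: "l2 h" and small: "sqrt (sq_norm h) < \<delta>"
    define B where "B = sqrt (sq_norm h)"
    have B: "B \<ge> 0" "B < \<delta>" "sq_norm h = B\<^sup>2" "\<And>x. \<bar>h x\<bar> \<le> B"
      using small abs_le_sqrt_sq_norm[OF h] by (auto simp: B_def)
    \<comment> \<open>the remainder of first order at a vertex, and a summable majorant\<close>
    define \<rho> where "\<rho> x = F x (u x + h x) - F x (u x) - h x * f x (u x)" for x
    define p where "p x = (if x \<in> S then \<eta> * B else 0) + 2 * K * (\<bar>off S u x * h x\<bar> + (h x)\<^sup>2)" for x
    have on: "((\<lambda>x. if x \<in> S then \<eta> * B else 0) has_sum (real (card S) * (\<eta> * B))) UNIV"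
      by (rule has_sum_finite_neutralI[OF S(1)]) auto
    have off: "(\<lambda>x. \<bar>off S u x * h x\<bar>) summable_on UNIV" by (rule l2_mult(2)[OF l2_off[OF u] h])
    have h2: "(\<lambda>x. (h x)\<^sup>2) summable_on UNIV" using h by (simp add: l2_def)
    have p: "p summable_on UNIV"
      unfolding p_def[abs_def]
      by (intro summable_on_add summable_on_cmult_right off h2 has_sum_imp_summable[OF on])
    have bound: "\<bar>\<rho> x\<bar> \<le> p x" for x
    proof -
      obtain \<xi> where \<xi>: "\<bar>\<xi> - u x\<bar> \<le> \<bar>h x\<bar>" "F x (u x + h x) - F x (u x) = h x * f x \<xi>"
        using remainder_mvt .
      have "\<rho> x = h x * (f x \<xi> - f x (u x))" using \<xi>(2) by (simp add: \<rho>_def algebra_simps)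
      then have \<rho>: "\<bar>\<rho> x\<bar> = \<bar>h x\<bar> * \<bar>f x \<xi> - f x (u x)\<bar>" by (simp add: abs_mult)
      show ?thesis
      proof (cases "x \<in> S")
        case True
        have "\<bar>f x \<xi> - f x (u x)\<bar> \<le> \<eta>"
          by (intro less_imp_le d(2)) (use \<xi>(1) B(2) B(4)[of x] \<delta>(2) d0(3)[OF True] in linarith)
        then have "\<bar>\<rho> x\<bar> \<le> B * \<eta>" unfolding \<rho> using B by (intro mult_mono) auto
        moreover have "0 \<le> 2 * K * (\<bar>off S u x * h x\<bar> + (h x)\<^sup>2)" using K(1) by simp
        ultimately show ?thesis using True by (simp add: p_def mult.commute)
      next
        case False
        have ux: "\<bar>u x\<bar> \<le> sqrt (sq_norm u)" by (rule abs_le_sqrt_sq_norm[OF u])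
        have "\<bar>f x (u x)\<bar> \<le> K * \<bar>u x\<bar>" by (rule K(2)) (use ux in linarith)
        moreover have "\<bar>f x \<xi>\<bar> \<le> K * \<bar>\<xi>\<bar>"
          by (rule K(2)) (use ux \<xi>(1) B(2) B(4)[of x] \<delta>(2) d0(2) in linarith)
        moreover have "K * \<bar>\<xi>\<bar> \<le> K * (\<bar>u x\<bar> + \<bar>h x\<bar>)"
          using \<xi>(1) K(1) by (intro mult_left_mono) auto
        moreover have "0 \<le> K * \<bar>h x\<bar>" using K(1) by simp
        moreover have "K * (\<bar>u x\<bar> + \<bar>h x\<bar>) = K * \<bar>u x\<bar> + K * \<bar>h x\<bar>"
          "2 * K * (\<bar>u x\<bar> + \<bar>h x\<bar>) = 2 * (K * \<bar>u x\<bar>) + 2 * (K * \<bar>h x\<bar>)"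
          by (simp_all add: algebra_simps)
        ultimately have "\<bar>f x \<xi> - f x (u x)\<bar> \<le> 2 * K * (\<bar>u x\<bar> + \<bar>h x\<bar>)"
          by linarith
        then have "\<bar>\<rho> x\<bar> \<le> \<bar>h x\<bar> * (2 * K * (\<bar>u x\<bar> + \<bar>h x\<bar>))"
          unfolding \<rho> by (intro mult_left_mono) auto
        also have "\<bar>h x\<bar> * (2 * K * (\<bar>u x\<bar> + \<bar>h x\<bar>)) = 2 * K * (\<bar>u x\<bar> * \<bar>h x\<bar> + \<bar>h x\<bar> * \<bar>h x\<bar>)"
          by (simp only: algebra_simps)
        also have "\<dots> = p x" using False by (simp add: p_def off_def abs_mult power2_eq_square)
        finally show ?thesis .
      qed
    qed
    have "\<bar>infsum \<rho> UNIV\<bar> \<le> infsum p UNIV" by (rule infsum_dominated[OF p]) (rule bound)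
    also have "\<dots> = real (card S) * (\<eta> * B) + 2 * K * ((\<Sum>\<^sub>\<infinity>x. \<bar>off S u x * h x\<bar>) + sq_norm h)"
    proof -
      have "infsum p UNIV = (\<Sum>\<^sub>\<infinity>x. if x \<in> S then \<eta> * B else 0) + (\<Sum>\<^sub>\<infinity>x. 2 * K * (\<bar>off S u x * h x\<bar> + (h x)\<^sup>2))"
        unfolding p_def
        by (rule infsum_add) (intro summable_on_add summable_on_cmult_right off h2 has_sum_imp_summable[OF on])+
      also have "(\<Sum>\<^sub>\<infinity>x. if x \<in> S then \<eta> * B else 0) = real (card S) * (\<eta> * B)" by (rule infsumI[OF on])
      also have "(\<Sum>\<^sub>\<infinity>x. 2 * K * (\<bar>off S u x * h x\<bar> + (h x)\<^sup>2)) = 2 * K * ((\<Sum>\<^sub>\<infinity>x. \<bar>off S u x * h x\<bar>) + sq_norm h)"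
        by (simp only: infsum_cmult_right' infsum_add[OF off h2] sq_norm_def)
      finally show ?thesis .
    qed
    also have "(\<Sum>\<^sub>\<infinity>x. \<bar>off S u x * h x\<bar>) \<le> e / (8 * (K + 1)) * B"
    proof -
      have "sqrt (sq_norm (off S u)) \<le> e / (8 * (K + 1))"
        using real_sqrt_le_mono[OF S(2)] e K(1) by simp
      then show ?thesis
        using cauchy_schwarz[OF l2_off[OF u] h, of S] mult_right_mono[of "sqrt (sq_norm (off S u))" "e / (8 * (K + 1))" B] B(1)
        unfolding B_def by linarith
    qed
    finally have "\<bar>infsum \<rho> UNIV\<bar> \<le> real (card S) * (\<eta> * B) + 2 * K * (e / (8 * (K + 1)) * B + B\<^sup>2)"
      using K(1) B(3) by (simp add: mult_left_mono)
    moreover have "real (card S) * (\<eta> * B) \<le> e / 4 * B"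
    proof -
      have "real (card S) * \<eta> \<le> e / 4" using e by (simp add: \<eta>_def field_simps)
      from mult_right_mono[OF this B(1)] show ?thesis by (simp only: mult.assoc)
    qed
    moreover have "2 * K * (e / (8 * (K + 1)) * B) \<le> e / 4 * B"
    proof -
      have "2 * K * (e / (8 * (K + 1))) \<le> e / 4" using e K(1) by (simp add: field_simps)
      from mult_right_mono[OF this B(1)] show ?thesis by (simp only: mult.assoc)
    qed
    ultimately have rem: "\<bar>infsum \<rho> UNIV\<bar> \<le> e / 2 * B + 2 * K * B\<^sup>2" by (simp add: distrib_left)
    have \<rho>sum: "\<rho> summable_on UNIV" by (rule summable_dominated(1)[OF p]) (rule bound)
    have eq: "\<Phi> (\<lambda>x. u x + h x) - \<Phi> u - (\<Sum>\<^sub>\<infinity>x. h x * (L u x - f x (u x))) = Q h / 2 - infsum \<rho> UNIV"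
    proof -
      have "(\<Sum>\<^sub>\<infinity>x. F x (u x + h x)) = (\<Sum>\<^sub>\<infinity>x. \<rho> x + (F x (u x) + h x * f x (u x)))"
        by (rule infsum_cong) (simp add: \<rho>_def)
      also have "\<dots> = infsum \<rho> UNIV + ((\<Sum>\<^sub>\<infinity>x. F x (u x)) + (\<Sum>\<^sub>\<infinity>x. h x * f x (u x)))"
        by (subst infsum_add, (intro \<rho>sum summable_on_add F_summable u l2_mult h l2_fu)+)+ (rule refl)
      finally have 1: "(\<Sum>\<^sub>\<infinity>x. F x (u x + h x)) = infsum \<rho> UNIV + ((\<Sum>\<^sub>\<infinity>x. F x (u x)) + (\<Sum>\<^sub>\<infinity>x. h x * f x (u x)))" .
      have "(\<Sum>\<^sub>\<infinity>x. h x * L u x) = (\<Sum>\<^sub>\<infinity>x. h x * (L u x - f x (u x)) + h x * f x (u x))"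
        by (rule infsum_cong) (simp add: algebra_simps)
      also have "\<dots> = (\<Sum>\<^sub>\<infinity>x. h x * (L u x - f x (u x))) + (\<Sum>\<^sub>\<infinity>x. h x * f x (u x))"
        by (intro infsum_add l2_mult l2_diff h u l2_L l2_fu)
      finally have 2: "(\<Sum>\<^sub>\<infinity>x. h x * L u x) = (\<Sum>\<^sub>\<infinity>x. h x * (L u x - f x (u x))) + (\<Sum>\<^sub>\<infinity>x. h x * f x (u x))" .
      have "1/2 * (a + 2 * b + c) - (r + (s + t)) - (1/2 * a - s) - d = c / 2 - r" if "b = d + t"
        for a b c d r s t :: real using that by (simp add: add_divide_distrib)
      from this[OF 2] show ?thesis unfolding \<Phi>_def 1 Q_add[OF u h] .
    qed
    have "0 \<le> Q h" using Q_ge[OF h] V0 B(3) by (metis mult_nonneg_nonneg less_imp_le order_trans sq_norm_nonneg)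
    moreover have "Q h \<le> form_bound * B\<^sup>2" using Q_le[OF h] B(3) by (simp add: form_bound_def)
    ultimately have "\<bar>Q h / 2 - infsum \<rho> UNIV\<bar> \<le> e / 2 * B + C * B\<^sup>2"
      using rem by (simp add: C_def distrib_right)
    also have "C * B\<^sup>2 \<le> e / 4 * B"
    proof -
      have "C * B \<le> C * \<delta>" using B(2) C by (intro mult_left_mono) auto
      also have "\<dots> \<le> e / 4" using \<delta>(3) C by (simp add: field_simps)
      finally have "C * B \<le> e / 4" .
      from mult_right_mono[OF this B(1)] show ?thesis by (simp only: power2_eq_square mult.assoc)
    qed
    also have "e / 2 * B + e / 4 * B \<le> e * B"
    proof -
      have "0 \<le> e * B" using e B(1) by simp
      moreover have "e / 2 * B + e / 4 * B = 3/4 * (e * B)" by (simp add: field_simps)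
      ultimately show ?thesis by linarith
    qed
    finally show "\<bar>\<Phi> (\<lambda>x. u x + h x) - \<Phi> u - (\<Sum>\<^sub>\<infinity>x. h x * (L u x - f x (u x)))\<bar> \<le> e * sqrt (sq_norm h)"
      unfolding eq by (simp only: B_def)
  qed
qed

lemma J_eq:
  assumes "l2 u"
  shows "J u = (\<Sum>\<^sub>\<infinity>x. u x * (L u x - f x (u x)))"
proof -
  have "(\<Sum>\<^sub>\<infinity>x. u x * L u x) = (\<Sum>\<^sub>\<infinity>x. u x * (L u x - f x (u x)) + f x (u x) * u x)"
    by (rule infsum_cong) (simp add: algebra_simps)
  also have "\<dots> = (\<Sum>\<^sub>\<infinity>x. u x * (L u x - f x (u x))) + (\<Sum>\<^sub>\<infinity>x. f x (u x) * u x)"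
    by (intro infsum_add l2_mult l2_diff assms l2_L l2_fu)
  finally show ?thesis using Q_eq[OF assms] by (simp add: J_def)
qed

text \<open>Uniqueness of the derivative, tested in the direction \<open>v\<close> only: it is \<open>0\<close> by assumption and \<open>J v\<close> by
the formula.\<close>

lemma critical_point_in_N:
  assumes "critical_point adj \<Phi> v" "\<Phi> v > 0"
  shows "v \<in> N"
proof -
  have v: "l2 v" using assms(1) by (simp add: critical_point_def H1_eq)
  have "\<exists>x. v x \<noteq> 0"
  proof (rule ccontr)
    assume "\<not> ?thesis"
    then have "v = (\<lambda>_. 0)" by auto
    then have "\<Phi> v = 0" using Q_cmult[of 0 v] by (simp add: \<Phi>_def)
    then show False using assms(2) by simp
  qed
  then obtain x where x: "v x \<noteq> 0" by blast
  define B where "B = sqrt (sq_norm v)"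
  have B: "B > 0" using sq_norm_pos[OF v x] by (simp add: B_def)
  define C where "C = sqrt (1 + 2 * D)"
  have C: "C > 0" by (simp add: C_def add_pos_nonneg)
  have "J v = 0"
  proof (rule ccontr)
    assume J: "J v \<noteq> 0"
    define e where "e = \<bar>J v\<bar> / 2 / ((C + 1) * B)"
    have e: "e > 0" using J B C by (simp add: e_def)
    obtain d1 where d1: "d1 > 0"
      "\<And>h. l2 h \<Longrightarrow> H1_norm adj h < d1 \<Longrightarrow> \<bar>\<Phi> (\<lambda>x. v x + h x) - \<Phi> v - 0\<bar> \<le> e * H1_norm adj h"
      using assms(1) e unfolding critical_point_def has_H1_derivative_def H1_eq mem_Collect_eq by blast
    obtain d2 where d2: "d2 > 0" "\<And>h. l2 h \<Longrightarrow> sqrt (sq_norm h) < d2 \<Longrightarrow>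
      \<bar>\<Phi> (\<lambda>x. v x + h x) - \<Phi> v - (\<Sum>\<^sub>\<infinity>x. h x * (L v x - f x (v x)))\<bar> \<le> e * sqrt (sq_norm h)"
      using frechet_derivative[OF v e] by blast
    define s where "s = min (d1 / (2 * C * B)) (d2 / (2 * B))"
    have s: "s > 0" using d1(1) d2(1) B C by (simp add: s_def)
    have s1: "C * (s * B) < d1"
    proof -
      have "s \<le> d1 / (2 * C * B)" by (simp add: s_def)
      then have "C * (s * B) \<le> d1 / 2" using B C by (simp add: field_simps)
      then show ?thesis using d1(1) by linarith
    qed
    have s2: "s * B < d2"
    proof -
      have "s \<le> d2 / (2 * B)" by (simp add: s_def)
      then have "s * B \<le> d2 / 2" using B by (simp add: field_simps)
      then show ?thesis using d2(1) by linarith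
    qed
    define h where "h = (\<lambda>x. s * v x)"
    have h: "l2 h" unfolding h_def by (rule l2_cmult[OF v])
    have nh: "sqrt (sq_norm h) = s * B" unfolding h_def sq_norm_cmult B_def using s by (simp add: real_sqrt_mult)
    have Hh: "H1_norm adj h \<le> C * (s * B)" using H1_norm_bounds(2)[OF h] unfolding nh C_def .
    have "\<bar>\<Phi> (\<lambda>x. v x + h x) - \<Phi> v - 0\<bar> \<le> e * H1_norm adj h"
      by (rule d1(2)[OF h]) (use Hh s1 in linarith)
    also have "\<dots> \<le> e * (C * (s * B))" using Hh e by (intro mult_left_mono) auto
    finally have 1: "\<bar>\<Phi> (\<lambda>x. v x + h x) - \<Phi> v\<bar> \<le> e * (C * (s * B))" by simp
    have "(\<Sum>\<^sub>\<infinity>x. h x * (L v x - f x (v x))) = s * J v"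
      unfolding J_eq[OF v] infsum_cmult_right'[symmetric] by (rule infsum_cong) (simp add: h_def)
    then have 2: "\<bar>\<Phi> (\<lambda>x. v x + h x) - \<Phi> v - s * J v\<bar> \<le> e * (s * B)"
      using d2(2)[OF h] s2 unfolding nh by simp
    have "\<bar>s * J v\<bar> \<le> e * (C * (s * B)) + e * (s * B)" using 1 2 by linarith
    also have "\<dots> = s * (e * ((C + 1) * B))" by (simp add: algebra_simps)
    also have "e * ((C + 1) * B) = \<bar>J v\<bar> / 2"
    proof -
      have "(C + 1) * B \<noteq> 0" using B C by simp
      then show ?thesis unfolding e_def by (rule nonzero_eq_divide_eq[THEN iffD1, OF _ refl])
    qed
    finally show False using s J by (simp add: abs_mult)
  qed
  then show ?thesis using v x by (auto simp: N_def)
qed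

lemma minimizer_ground_state:
  assumes uN: "u \<in> N" and min: "\<And>w. w \<in> N \<Longrightarrow> \<Phi> u \<le> \<Phi> w"
  shows "ground_state adj V f u"
  unfolding ground_state_def
proof (intro conjI allI impI)
  note u = N_D[OF uN]
  have sol: "L u x = f x (u x)" for x by (rule minimizer_solves[OF uN min])
  then show "solution adj V f u" using u(1) by (simp add: solution_def H1_eq L_def)
  show "\<Phi> u > 0" by (rule u(4))
  show "critical_point adj \<Phi> u"
    unfolding critical_point_def has_H1_derivative_def H1_eq mem_Collect_eq
  proof (intro conjI u(1) ballI allI impI)
    show "\<exists>K. \<forall>v\<in>{u. l2 u}. \<bar>0\<bar> \<le> K * H1_norm adj v" by (rule exI[of _ 0]) simp
    fix e :: real assume e: "e > 0"
    obtain d where d: "d > 0" "\<And>h. l2 h \<Longrightarrow> sqrt (sq_norm h) < d \<Longrightarrow>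
      \<bar>\<Phi> (\<lambda>x. u x + h x) - \<Phi> u - (\<Sum>\<^sub>\<infinity>x. h x * (L u x - f x (u x)))\<bar> \<le> e * sqrt (sq_norm h)"
      using frechet_derivative[OF u(1) e] by blast
    have "\<bar>\<Phi> (\<lambda>x. u x + h x) - \<Phi> u - 0\<bar> \<le> e * H1_norm adj h" if h: "l2 h" "H1_norm adj h < d" for h
    proof -
      have "sqrt (sq_norm h) \<le> H1_norm adj h" by (rule H1_norm_bounds[OF h(1)])
      then show ?thesis
        using d(2)[OF h(1)] h(2) mult_left_mono[of "sqrt (sq_norm h)" "H1_norm adj h" e, OF _ less_imp_le[OF e]] sol by simp
    qed
    then show "\<exists>\<delta>>0. \<forall>h\<in>{u. l2 u}. H1_norm adj h < \<delta> \<longrightarrow> \<bar>\<Phi> (\<lambda>x. u x + h x) - \<Phi> u - 0\<bar> \<le> e * H1_norm adj h"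
      using d(1) by blast
  qed simp_all
  fix v assume "critical_point adj \<Phi> v \<and> \<Phi> v > 0"
  then show "\<Phi> u \<le> \<Phi> v" using critical_point_in_N min by blast
qed

section \<open>Existence of minimizers\<close>

lemma weak_limit:
  assumes uN: "\<And>n. u n \<in> N" and lim: "(\<lambda>n. \<Phi> (u n)) \<longlonglongrightarrow> c"
  obtains k v M where "strict_mono (k :: nat \<Rightarrow> nat)" "l2 v" "\<And>x. (\<lambda>n. u (k n) x) \<longlonglongrightarrow> v x"
    "\<And>n. sq_norm (u n) \<le> M"
proof -
  obtain C where "\<And>n. norm (\<Phi> (u n)) \<le> C"
    using convergent_imp_Bseq[OF convergentI[OF lim]] unfolding Bseq_def by blast
  then have C: "\<Phi> (u n) \<le> C" for n by (metis abs_le_D1 real_norm_def)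
  obtain M where M: "\<And>u. u \<in> N \<Longrightarrow> \<Phi> u \<le> C \<Longrightarrow> sq_norm u \<le> M" using sublevel_bounded[of C] by blast
  have "sq_norm (u n) \<le> M" for n using M uN C by blast
  then show thesis using weak_subsequence[of u M] N_D(1)[OF uN] that by metis
qed

text \<open>Values bounded away from \<open>0\<close> on a fixed finite set survive in the pointwise limit.\<close>

lemma minimizer_if_concentrated:
  assumes uN: "\<And>n. u n \<in> N" and lim: "(\<lambda>n. \<Phi> (u n)) \<longlonglongrightarrow> c"
    and low: "\<And>w. w \<in> N \<Longrightarrow> c \<le> \<Phi> w"
    and R: "finite R" "d > 0" "\<And>n. \<exists>y\<in>R. \<bar>u n y\<bar> \<ge> d"
  obtains w where "w \<in> N" "\<And>z. z \<in> N \<Longrightarrow> \<Phi> w \<le> \<Phi> z"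
proof -
  obtain k v where k: "strict_mono (k :: nat \<Rightarrow> nat)" and v: "l2 v" "\<And>x. (\<lambda>n. u (k n) x) \<longlonglongrightarrow> v x"
    using weak_limit[OF uN lim] by metis
  have "\<exists>y\<in>R. v y \<noteq> 0"
  proof (rule ccontr)
    assume "\<not> ?thesis"
    then have "\<forall>\<^sub>F n in sequentially. \<bar>u (k n) y\<bar> < d" if "y \<in> R" for y
      using order_tendstoD(2)[OF tendsto_rabs[OF v(2)[of y]], of d] that R(2) by simp
    then have "\<forall>\<^sub>F n in sequentially. \<forall>y\<in>R. \<bar>u (k n) y\<bar> < d"
      by (intro eventually_ball_finite R(1)) blast
    then obtain n where "\<forall>y\<in>R. \<bar>u (k n) y\<bar> < d" using eventually_happens by force
    then show False using R(3)[of "k n"] by force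
  qed
  then obtain y where y: "v y \<noteq> 0" by blast
  have "(\<lambda>n. \<Phi> (u (k n))) \<longlonglongrightarrow> c" using LIMSEQ_subseq_LIMSEQ[OF lim k] by (simp add: o_def)
  then obtain w where "w \<in> N" "\<Phi> w \<le> c" using attained[OF uN _ low v y] by blast
  then show thesis using that low order_trans by metis
qed

lemma translation:
  assumes g: "bij g" "\<And>x y. adj (g x) (g y) \<longleftrightarrow> adj x y" "\<And>x. V (g x) = V x" "\<And>x. f (g x) = f x"
    and u: "u \<in> N"
  shows "(\<lambda>x. u (g x)) \<in> N" "\<Phi> (\<lambda>x. u (g x)) = \<Phi> u"
proof -
  note u' = N_D[OF u]
  have inf: "(\<Sum>\<^sub>\<infinity>x. k (g x)) = (\<Sum>\<^sub>\<infinity>x. k x)" for k :: "'v \<Rightarrow> real"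
    by (rule infsum_reindex_bij_betw[OF g(1)])
  have nbr: "bij_betw g {y. adj x y} {y. adj (g x) y}" for x
  proof (rule bij_betw_imageI)
    show "inj_on g {y. adj x y}" using g(1) bij_is_inj inj_on_subset by blast
    show "g ` {y. adj x y} = {y. adj (g x) y}"
      using g(2) bij_is_surj[OF g(1)] by (auto simp: image_iff) (metis surjD)
  qed
  have grad: "grad_sq adj (\<lambda>x. u (g x)) x = grad_sq adj u (g x)" for x
    unfolding grad_sq_def by (rule sum.reindex_bij_betw[OF nbr])
  have Q: "Q (\<lambda>x. u (g x)) = Q u"
    unfolding Q_def grad using inf[of "\<lambda>x. 1/2 * grad_sq adj u x + V x * (u x)\<^sup>2"] by (simp add: g(3))
  have "(\<Sum>\<^sub>\<infinity>x. f x (u (g x)) * u (g x)) = (\<Sum>\<^sub>\<infinity>x. f x (u x) * u x)"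
    using inf[of "\<lambda>x. f x (u x) * u x"] by (simp add: g(4))
  then have "J (\<lambda>x. u (g x)) = 0" using u'(2) by (simp add: J_def Q)
  moreover have "l2 (\<lambda>x. u (g x))"
    using summable_on_reindex_bij_betw[OF g(1), of "\<lambda>x. (u x)\<^sup>2"] u'(1) by (simp add: l2_def)
  moreover have "\<exists>x. u (g x) \<noteq> 0" using u'(6) bij_is_surj[OF g(1)] by (metis surjD)
  ultimately show "(\<lambda>x. u (g x)) \<in> N" by (simp add: N_def)
  have "(\<Sum>\<^sub>\<infinity>x. F x (u (g x))) = (\<Sum>\<^sub>\<infinity>x. F x (u x))"
    using inf[of "\<lambda>x. F x (u x)"] by (simp add: g(4))
  then show "\<Phi> (\<lambda>x. u (g x)) = \<Phi> u" by (simp add: \<Phi>_def Q)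
qed

text \<open>A minimizing sequence may escape to infinity.  Composing its members with symmetries keeps them
minimizing and brings a vertex of nonvanishing into the finite set \<open>R\<close>.\<close>

lemma minimizer_invariant:
  assumes R: "finite R"
    and cover: "\<And>x. \<exists>g. \<exists>y\<in>R. g y = x \<and> bij g \<and> (\<forall>x y. adj (g x) (g y) \<longleftrightarrow> adj x y) \<and>
      (\<forall>x. V (g x) = V x) \<and> (\<forall>x. f (g x) = f x)"
  obtains w where "w \<in> N" "\<And>z. z \<in> N \<Longrightarrow> \<Phi> w \<le> \<Phi> z"
proof -
  obtain u where u: "\<And>n. u n \<in> N" "(\<lambda>n. \<Phi> (u n)) \<longlonglongrightarrow> Inf (\<Phi> ` N)"
    "\<And>w. w \<in> N \<Longrightarrow> Inf (\<Phi> ` N) \<le> \<Phi> w"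
    using minimizing_sequence by metis
  obtain d where d: "d > 0" "\<And>u. u \<in> N \<Longrightarrow> \<exists>x. \<bar>u x\<bar> \<ge> d" using nonvanishing by metis
  have "\<exists>g. (\<exists>y\<in>R. \<bar>u n (g y)\<bar> \<ge> d) \<and> (\<lambda>x. u n (g x)) \<in> N \<and> \<Phi> (\<lambda>x. u n (g x)) = \<Phi> (u n)" for n
  proof -
    obtain x where "\<bar>u n x\<bar> \<ge> d" using d(2)[OF u(1)] by blast
    then show ?thesis using cover[of x] translation[OF _ _ _ _ u(1)[of n]] by metis
  qed
  then obtain g where g: "\<And>n. \<exists>y\<in>R. \<bar>u n (g n y)\<bar> \<ge> d" "\<And>n. (\<lambda>x. u n (g n x)) \<in> N"
    "\<And>n. \<Phi> (\<lambda>x. u n (g n x)) = \<Phi> (u n)" by metis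
  show thesis
    by (rule minimizer_if_concentrated[of "\<lambda>n x. u n (g n x)", OF g(2) _ u(3) R d(1) g(1)])
      (use g(3) u(2) that in auto)
qed

end

text \<open>Either some minimizing sequence for \<open>V\<close> has a nonzero limit, or it sees only the potential at infinity.
In the latter case its members, scaled onto the Nehari set for \<open>Vinf\<close> by bounded factors,
have asymptotically no more energy, so the minimizer \<open>w\<close> at infinity has energy at most \<open>c\<close>.
As \<open>V \<le> Vinf\<close>, \<open>w\<close> has \<open>J \<le> 0\<close> for \<open>V\<close>, and \<open>\<Psi>\<close> is independent of the potential.\<close>

lemma minimizer_below_infinity:
  assumes A: "nehari adj D V V0 Vinf f" and I: "nehari adj D (\<lambda>_. Vinf) V0 Vinf f"
    and lim: "(V \<longlongrightarrow> Vinf) cofinite"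
    and w: "w \<in> nehari.N adj (\<lambda>_. Vinf) f"
      "\<And>z. z \<in> nehari.N adj (\<lambda>_. Vinf) f \<Longrightarrow> energy adj (\<lambda>_. Vinf) f w \<le> energy adj (\<lambda>_. Vinf) f z"
  obtains u where "u \<in> nehari.N adj V f" "\<And>z. z \<in> nehari.N adj V f \<Longrightarrow> energy adj V f u \<le> energy adj V f z"
proof -
  interpret A: nehari adj D V V0 Vinf f by fact
  interpret I: nehari adj D "\<lambda>_. Vinf" V0 Vinf f by fact
  define c where "c = Inf (A.\<Phi> ` A.N)"
  obtain u where u: "\<And>n. u n \<in> A.N" "(\<lambda>n. A.\<Phi> (u n)) \<longlonglongrightarrow> c" "\<And>w. w \<in> A.N \<Longrightarrow> c \<le> A.\<Phi> w"
    using A.minimizing_sequence unfolding c_def by metis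
  obtain k v M where k: "strict_mono (k :: nat \<Rightarrow> nat)" and v: "l2 v" "\<And>x. (\<lambda>n. u (k n) x) \<longlonglongrightarrow> v x"
    and M: "\<And>n. sq_norm (u n) \<le> M"
    using A.weak_limit[OF u(1,2)] by metis
  have uk: "(\<lambda>n. A.\<Phi> (u (k n))) \<longlonglongrightarrow> c" using LIMSEQ_subseq_LIMSEQ[OF u(2) k] by (simp add: o_def)
  have "\<exists>w\<in>A.N. A.\<Phi> w \<le> c"
  proof (cases "\<exists>y. v y \<noteq> 0")
    case True
    then show ?thesis using A.attained[OF u(1) uk u(3) v] by metis
  next
    case False
    then have v0: "(\<lambda>n. u (k n) x) \<longlonglongrightarrow> 0" for x using v(2)[of x] by simp
    have gap: "I.Q z - A.Q z = (\<Sum>\<^sub>\<infinity>x. (Vinf - V x) * (z x)\<^sup>2)"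
      "(\<lambda>x. (Vinf - V x) * (z x)\<^sup>2) summable_on UNIV" if "l2 z" for z
    proof -
      have eq: "(\<lambda>x. (Vinf - V x) * (z x)\<^sup>2) = (\<lambda>x. Vinf * (z x)\<^sup>2 + - 1 * (V x * (z x)\<^sup>2))"
        by (auto simp: algebra_simps)
      show "(\<lambda>x. (Vinf - V x) * (z x)\<^sup>2) summable_on UNIV"
        unfolding eq by (intro summable_on_add summable_on_cmult_right I.V_sq_summable[OF that] A.V_sq_summable[OF that])
      have "(\<Sum>\<^sub>\<infinity>x. (Vinf - V x) * (z x)\<^sup>2) = (\<Sum>\<^sub>\<infinity>x. Vinf * (z x)\<^sup>2) + - 1 * (\<Sum>\<^sub>\<infinity>x. V x * (z x)\<^sup>2)"
        unfolding eq infsum_cmult_right'[symmetric, of "- 1"]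
        by (intro infsum_add summable_on_cmult_right I.V_sq_summable[OF that] A.V_sq_summable[OF that])
      then show "I.Q z - A.Q z = (\<Sum>\<^sub>\<infinity>x. (Vinf - V x) * (z x)\<^sup>2)"
        unfolding A.Q_split[OF that] I.Q_split[OF that] by simp
    qed
    have gap0: "(\<lambda>n. I.Q (u (k n)) - A.Q (u (k n))) \<longlonglongrightarrow> 0"
    proof (rule LIMSEQ_I)
      fix e :: real assume e: "e > 0"
      define e' where "e' = e / (2 * (\<bar>M\<bar> + 1))"
      have e': "e' > 0" "e' * \<bar>M\<bar> < e / 2" using e by (auto simp: e'_def field_simps)
      \<comment> \<open>off \<open>S\<close> the potential is within \<open>e'\<close> of its limit; on \<open>S\<close> the functions tend to \<open>0\<close>\<close>
      define S where "S = {x. \<not> dist (V x) Vinf < e'}"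
      have S: "finite S"
        using tendstoD[OF lim e'(1)] by (simp add: S_def eventually_cofinite)
      have "(\<lambda>n. \<Sum>x\<in>S. (Vinf - V x) * (u (k n) x)\<^sup>2) \<longlonglongrightarrow> (\<Sum>x\<in>S. (Vinf - V x) * 0\<^sup>2)"
        by (intro tendsto_intros v0)
      then have "\<forall>\<^sub>F n in sequentially. (\<Sum>x\<in>S. (Vinf - V x) * (u (k n) x)\<^sup>2) < e / 2"
        using e by (intro order_tendstoD(2)) auto
      then obtain n0 where n0: "\<And>n. n \<ge> n0 \<Longrightarrow> (\<Sum>x\<in>S. (Vinf - V x) * (u (k n) x)\<^sup>2) < e / 2"
        by (auto simp: eventually_sequentially)
      have "norm (I.Q (u (k n)) - A.Q (u (k n)) - 0) < e" if "n \<ge> n0" for n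
      proof -
        note un = A.N_D(1)[OF u(1)[of "k n"]]
        have u2: "(\<lambda>x. (u (k n) x)\<^sup>2) summable_on UNIV" using un by (simp add: l2_def)
        have nonneg: "0 \<le> (Vinf - V x) * (u (k n) x)\<^sup>2" for x using A.V_le[of x] by simp
        have "(\<Sum>\<^sub>\<infinity>x. off S (\<lambda>x. (Vinf - V x) * (u (k n) x)\<^sup>2) x) \<le> (\<Sum>\<^sub>\<infinity>x. e' * (u (k n) x)\<^sup>2)"
        proof (rule infsum_mono)
          show "off S (\<lambda>x. (Vinf - V x) * (u (k n) x)\<^sup>2) summable_on UNIV"
            by (rule summable_dominated(1)[OF gap(2)[OF un]]) (use nonneg in \<open>auto simp: off_def\<close>)
          show "(\<lambda>x. e' * (u (k n) x)\<^sup>2) summable_on UNIV" by (rule summable_on_cmult_right[OF u2])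
          show "off S (\<lambda>x. (Vinf - V x) * (u (k n) x)\<^sup>2) x \<le> e' * (u (k n) x)\<^sup>2" for x
            using e'(1) by (auto simp: off_def S_def dist_real_def intro!: mult_right_mono)
        qed
        also have "\<dots> = e' * sq_norm (u (k n))" by (simp only: infsum_cmult_right' sq_norm_def)
        also have "\<dots> \<le> e' * \<bar>M\<bar>" using M[of "k n"] e'(1) by (intro mult_left_mono) auto
        finally have "I.Q (u (k n)) - A.Q (u (k n)) < e"
          using n0[OF that] e'(2) infsum_split[OF gap(2)[OF un] S] gap(1)[OF un] by linarith
        moreover have "0 \<le> I.Q (u (k n)) - A.Q (u (k n))"
          unfolding gap(1)[OF un] by (rule infsum_nonneg) (rule nonneg)
        ultimately show ?thesis by simp
      qed
      then show "\<exists>no. \<forall>n\<ge>no. norm (I.Q (u (k n)) - A.Q (u (k n)) - 0) < e" by blast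
    qed
    obtain d where d: "d > 0" "\<And>u. u \<in> A.N \<Longrightarrow> \<exists>x. \<bar>u x\<bar> \<ge> d" using A.nonvanishing by metis
    obtain T where T: "T > 0" "\<And>u y. l2 u \<Longrightarrow> sq_norm u \<le> M \<Longrightarrow> \<bar>u y\<bar> \<ge> d \<Longrightarrow> I.J (\<lambda>x. T * u x) \<le> 0"
      using I.rise[OF d(1)] by metis
    have le: "I.\<Phi> w \<le> A.\<Phi> (u (k n)) + T\<^sup>2 / 2 * (I.Q (u (k n)) - A.Q (u (k n)))" for n
    proof -
      note un = A.N_D[OF u(1)[of "k n"]]
      obtain y where y: "\<bar>u (k n) y\<bar> \<ge> d" using d(2)[OF u(1)] by blast
      have "I.J (\<lambda>x. T * u (k n) x) \<le> 0" by (rule T(2)[OF un(1) M y])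
      moreover have "T * u (k n) y \<noteq> 0" using y d(1) T(1) by auto
      ultimately obtain t where t: "0 < t" "t \<le> 1" "(\<lambda>x. t * (T * u (k n) x)) \<in> I.N"
        using I.descent[OF l2_cmult[OF un(1)]] by metis
      \<comment> \<open>bounded by \<open>T\<close>, so the gap between the two forms stays negligible after scaling\<close>
      define r where "r = t * T"
      have r: "0 \<le> r" "r \<le> T" using t T(1) by (auto simp: r_def mult_le_cancel_right1)
      have "(\<lambda>x. r * u (k n) x) \<in> I.N" using t(3) by (simp add: r_def mult.assoc)
      then have "I.\<Phi> w \<le> I.\<Phi> (\<lambda>x. r * u (k n) x)" by (rule w(2))
      also have "\<dots> = A.\<Phi> (\<lambda>x. r * u (k n) x) + r\<^sup>2 / 2 * (I.Q (u (k n)) - A.Q (u (k n)))"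
        unfolding A.\<Phi>_def I.\<Phi>_def A.Q_cmult I.Q_cmult by (simp add: algebra_simps)
      also have "A.\<Phi> (\<lambda>x. r * u (k n) x) \<le> A.\<Phi> (u (k n))" by (rule A.ray_max[OF u(1) r(1)])
      also have "r\<^sup>2 / 2 * (I.Q (u (k n)) - A.Q (u (k n))) \<le> T\<^sup>2 / 2 * (I.Q (u (k n)) - A.Q (u (k n)))"
      proof (rule mult_right_mono)
        show "r\<^sup>2 / 2 \<le> T\<^sup>2 / 2" using r by (simp add: power_mono)
        show "0 \<le> I.Q (u (k n)) - A.Q (u (k n))"
          unfolding gap(1)[OF un(1)] by (rule infsum_nonneg) (simp add: A.V_le)
      qed
      finally show ?thesis by simp
    qed
    have "I.\<Phi> w \<le> c + T\<^sup>2 / 2 * 0"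
      by (rule LIMSEQ_le_const[OF tendsto_add[OF uk tendsto_mult[OF tendsto_const gap0]]]) (use le in blast)
    then have wc: "I.\<Phi> w \<le> c" by simp
    note w' = I.N_D[OF w(1)]
    obtain y where y: "w y \<noteq> 0" using w'(6) by blast
    have "0 \<le> I.Q w - A.Q w" unfolding gap(1)[OF w'(1)] by (rule infsum_nonneg) (simp add: A.V_le)
    then have "A.J w \<le> 0" using w'(5) by (simp add: A.J_def)
    then obtain z where "z \<in> A.N" "A.\<Phi> z \<le> A.\<Psi> w" using A.\<Psi>_lower[OF w'(1) y] by blast
    moreover have "A.\<Psi> w \<le> c" using wc w'(3) by simp
    ultimately show ?thesis by force
  qed
  then show thesis using that u(3) order_trans by metis
qed

text \<open>On bounded ranges of \<open>u\<close> the factor \<open>\<bar>u\<bar> powr (q - 2)\<close> is bounded, which turns the growth condition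
into a linear bound.\<close>

section \<open>Ground states\<close>

lemma nonlinearityI:
  fixes f :: "'v \<Rightarrow> real \<Rightarrow> real"
  assumes cont: "\<And>x. continuous_on UNIV (f x)"
    and a: "a > 0" and q: "q > 2" and bound: "\<And>x u. \<bar>f x u\<bar> \<le> a * (\<bar>u\<bar> + \<bar>u\<bar> powr (q - 1))"
    and small: "\<And>e. e > 0 \<Longrightarrow> \<forall>\<^sub>F u in at 0. \<forall>x. \<bar>f x u\<bar> \<le> e * \<bar>u\<bar>"
    and neg: "\<And>x. strict_mono_on {..<0} (\<lambda>u. f x u / \<bar>u\<bar>)"
    and pos: "\<And>x. strict_mono_on {0<..} (\<lambda>u. f x u / \<bar>u\<bar>)"
    and super: "\<And>C. \<forall>\<^sub>F u in at_infinity. \<forall>x. primitive (f x) u / u\<^sup>2 \<ge> C"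
  shows "nonlinearity f"
proof
  show "continuous_on UNIV (f x)" for x by (rule cont)
  have f0: "f x 0 = 0" for x using bound[of x 0] by simp
  show "\<exists>K\<ge>0. \<forall>x s. \<bar>s\<bar> \<le> M \<longrightarrow> \<bar>f x s\<bar> \<le> K * \<bar>s\<bar>" for M
  proof (intro exI[of _ "a * (1 + (\<bar>M\<bar> + 1) powr (q - 2))"] conjI allI impI)
    fix x s :: real assume s: "\<bar>s\<bar> \<le> M"
    have "\<bar>s\<bar> powr (q - 1) = \<bar>s\<bar> powr (q - 2) * \<bar>s\<bar>"
      using powr_add[of "\<bar>s\<bar>" "q - 2" 1] by (cases "s = 0") auto
    also have "\<dots> \<le> (\<bar>M\<bar> + 1) powr (q - 2) * \<bar>s\<bar>"
      using q s by (intro mult_right_mono powr_mono2) auto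
    finally have "a * (\<bar>s\<bar> + \<bar>s\<bar> powr (q - 1)) \<le> a * (\<bar>s\<bar> + (\<bar>M\<bar> + 1) powr (q - 2) * \<bar>s\<bar>)"
      using a by (intro mult_left_mono) auto
    then show "\<bar>f x s\<bar> \<le> a * (1 + (\<bar>M\<bar> + 1) powr (q - 2)) * \<bar>s\<bar>" for x
      using bound[of x s] by (simp add: algebra_simps)
  qed (use a in auto)
  show "\<exists>d>0. \<forall>x s. \<bar>s\<bar> < d \<longrightarrow> \<bar>f x s\<bar> \<le> e * \<bar>s\<bar>" if e: "e > 0" for e
  proof -
    obtain d where d: "d > 0" "\<And>u. u \<noteq> 0 \<Longrightarrow> dist u 0 < d \<Longrightarrow> \<forall>x. \<bar>f x u\<bar> \<le> e * \<bar>u\<bar>"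
      using small[OF e] unfolding eventually_at by blast
    have "\<bar>f x s\<bar> \<le> e * \<bar>s\<bar>" if "\<bar>s\<bar> < d" for x s
      using d(2)[of s] that f0 by (cases "s = 0") auto
    then show ?thesis using d(1) by blast
  qed
  show "f x s / s < f x t / t" if st: "0 < s * t" "\<bar>s\<bar> < \<bar>t\<bar>" for x s t
  proof (cases "s > 0")
    case True
    then have "0 < t" using st(1) by (simp add: zero_less_mult_iff)
    then show ?thesis using strict_mono_onD[OF pos[of x], of s t] True st(2) by simp
  next
    case False
    then have "s < 0" "t < 0" using st(1) by (auto simp: zero_less_mult_iff)
    then show ?thesis using strict_mono_onD[OF neg[of x], of t s] st(2) by simp
  qed
  show "\<exists>R>0. \<forall>x s. \<bar>s\<bar> \<ge> R \<longrightarrow> primitive (f x) s \<ge> C * s\<^sup>2" for C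
  proof -
    obtain b where b: "\<And>u x. b \<le> \<bar>u\<bar> \<Longrightarrow> primitive (f x) u / u\<^sup>2 \<ge> C"
      using super[of C] unfolding eventually_at_infinity by auto
    have "primitive (f x) s \<ge> C * s\<^sup>2" if "max b 1 \<le> \<bar>s\<bar>" for x s
      using b[of s x] that by (simp add: pos_le_divide_eq)
    then show ?thesis by (intro exI[of _ "max b 1"]) auto
  qed
qed

text \<open>A representative is chosen by expressing each orbit as the orbit of that vertex, so every vertex is
directly an image of a representative.\<close>

lemma orbit_representatives:
  assumes "subgroup \<Gamma> (aut_group adj)" "finitely_many_orbits ((aut_group adj)\<lparr>carrier := \<Gamma>\<rparr>)"
  obtains R where "finite R" "\<And>x. \<exists>g\<in>\<Gamma>. \<exists>y\<in>R. g y = x"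
    "\<And>g. g \<in> \<Gamma> \<Longrightarrow> bij g" "\<And>g x y. g \<in> \<Gamma> \<Longrightarrow> adj (g x) (g y) \<longleftrightarrow> adj x y"
proof -
  define orb where "orb x = {g x | g. g \<in> \<Gamma>}" for x
  have "orbits ((aut_group adj)\<lparr>carrier := \<Gamma>\<rparr>) UNIV (\<lambda>g. g) = range orb"
    by (auto simp: orbits_def orbit_def orb_def)
  then have "finite (range orb)" using assms(2) by (simp add: finitely_many_orbits_def)
  then obtain R where R: "finite R" "orb ` R = range orb"
    using finite_subset_image[of "range orb" orb UNIV] by auto
  have id: "id \<in> \<Gamma>" using subgroup.one_closed[OF assms(1)] by (simp add: aut_group_def)
  have "\<exists>g\<in>\<Gamma>. \<exists>y\<in>R. g y = x" for x
  proof -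
    have "x \<in> orb x" unfolding orb_def mem_Collect_eq by (rule exI[of _ id]) (simp add: id)
    moreover obtain y where y: "y \<in> R" "orb x = orb y" using R(2) by (metis imageE rangeI)
    ultimately obtain g where "g \<in> \<Gamma>" "x = g y" by (auto simp: orb_def)
    then show ?thesis using y(1) by blast
  qed
  moreover have "\<Gamma> \<subseteq> carrier (aut_group adj)" by (rule subgroup.subset[OF assms(1)])
  then have "\<And>g. g \<in> \<Gamma> \<Longrightarrow> bij g" "\<And>g x y. g \<in> \<Gamma> \<Longrightarrow> adj (g x) (g y) \<longleftrightarrow> adj x y"
    by (auto simp: aut_group_def)
  ultimately show thesis using that R(1) by blast
qed

theorem theorem1p4:
  fixes adj :: "'v \<Rightarrow> 'v \<Rightarrow> bool" and \<Gamma> :: "('v \<Rightarrow> 'v) set"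
  assumes "symp adj" and "irreflp adj" and "\<And>x. finite {y. adj x y}"
    and "quasi_transitive adj"
    and "subgroup \<Gamma> (aut_group adj)"
    and "finitely_many_orbits ((aut_group adj)\<lparr>carrier := \<Gamma>\<rparr>)"
  shows
    "(\<forall>(f :: real \<Rightarrow> real) (V :: 'v \<Rightarrow> real) (a :: real) (q :: real) (V0 :: real) (Vinf :: real).
        continuous_on UNIV f \<and>
        a > 0 \<and> q > 2 \<and> (\<forall>u. \<bar>f u\<bar> \<le> a * (\<bar>u\<bar> + \<bar>u\<bar> powr (q - 1))) \<and>
        f \<in> o[at 0](\<lambda>u. u) \<and>
        strict_mono_on {..<0} (\<lambda>u. f u / \<bar>u\<bar>) \<and>
        strict_mono_on {0<..} (\<lambda>u. f u / \<bar>u\<bar>) \<and>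
        filterlim (\<lambda>u. primitive f u / u\<^sup>2) at_top at_infinity \<and>
        0 < V0 \<and> bdd_below (range V) \<and> V0 \<le> (INF x. V x) \<and>
        bdd_above (range V) \<and> (SUP x. V x) = Vinf \<and>
        (V \<longlongrightarrow> Vinf) cofinite
      \<longrightarrow> (\<exists>u. ground_state adj V (\<lambda>_. f) u))
     \<and>
     (\<forall>(f :: 'v \<Rightarrow> real \<Rightarrow> real) (V :: 'v \<Rightarrow> real) (a :: real) (q :: real).
        (\<forall>x. continuous_on UNIV (f x)) \<and>
        a > 0 \<and> q > 2 \<and> (\<forall>x u. \<bar>f x u\<bar> \<le> a * (\<bar>u\<bar> + \<bar>u\<bar> powr (q - 1))) \<and>
        (\<forall>g\<in>\<Gamma>. \<forall>x. V (g x) = V x) \<and>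
        (\<forall>g\<in>\<Gamma>. \<forall>x u. f (g x) u = f x u) \<and>
        (\<forall>x. V x > 0) \<and>
        uniform_limit UNIV (\<lambda>u x. f x u / u) (\<lambda>x. 0) (at 0) \<and>
        (\<forall>x. strict_mono_on {..<0} (\<lambda>u. f x u / \<bar>u\<bar>)) \<and>
        (\<forall>x. strict_mono_on {0<..} (\<lambda>u. f x u / \<bar>u\<bar>)) \<and>
        (\<forall>C. \<forall>\<^sub>F u in at_infinity. \<forall>x. primitive (f x) u / u\<^sup>2 \<ge> C)
      \<longrightarrow> (\<exists>u. ground_state adj V f u))"
proof -
  obtain R where R: "finite R" "\<And>x. \<exists>g\<in>\<Gamma>. \<exists>y\<in>R. g y = x"
    and bij: "\<And>g. g \<in> \<Gamma> \<Longrightarrow> bij g" and aut: "\<And>g x y. g \<in> \<Gamma> \<Longrightarrow> adj (g x) (g y) \<longleftrightarrow> adj x y"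
    using orbit_representatives[OF assms(5,6)] by metis
  have orbit_const: "\<exists>y\<in>R. k x = k y" if "\<And>g x. g \<in> \<Gamma> \<Longrightarrow> k (g x) = k x" for k :: "'v \<Rightarrow> 'b" and x
    using R(2)[of x] that by metis
  define D where "D = Max ((\<lambda>x. card {y. adj x y}) ` R)"
  have deg_invariant: "card {y. adj (g x) y} = card {y. adj x y}" if g: "g \<in> \<Gamma>" for g x
  proof -
    have "{y. adj (g x) y} = g ` {y. adj x y}"
      using aut[OF g] bij_is_surj[OF bij[OF g]] by (auto simp: image_iff) (metis surjD)
    moreover have "inj_on g {y. adj x y}" using bij_is_inj[OF bij[OF g]] inj_on_subset by blast
    ultimately show ?thesis by (simp add: card_image)
  qed
  have "card {y. adj x y} \<le> D" for x
  proof -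
    obtain y where "y \<in> R" "card {z. adj x z} = card {z. adj y z}"
      using orbit_const[of "\<lambda>x. card {y. adj x y}" x] deg_invariant by blast
    then show ?thesis using R(1) by (simp add: D_def)
  qed
  then interpret bounded_degree_graph adj D
    using assms(1,3) by unfold_locales
  have minimizer: "\<exists>w\<in>nehari.N adj V f. \<forall>z\<in>nehari.N adj V f. energy adj V f w \<le> energy adj V f z"
    if "nehari adj D V V0 V1 f" "\<And>g x. g \<in> \<Gamma> \<Longrightarrow> V (g x) = V x" "\<And>g x. g \<in> \<Gamma> \<Longrightarrow> f (g x) = f x"
    for V V0 V1 f
  proof -
    interpret nehari adj D V V0 V1 f by fact
    have cover: "\<exists>g. \<exists>y\<in>R. g y = x \<and> bij g \<and> (\<forall>x y. adj (g x) (g y) \<longleftrightarrow> adj x y) \<and>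
      (\<forall>x. V (g x) = V x) \<and> (\<forall>x. f (g x) = f x)" for x
    proof -
      obtain g y where g: "g \<in> \<Gamma>" "y \<in> R" "g y = x" using R(2) by blast
      show ?thesis
        by (rule exI[of _ g], rule bexI[OF _ g(2)]) (simp add: g bij aut that(2,3))
    qed
    obtain w where "w \<in> N" "\<And>z. z \<in> N \<Longrightarrow> \<Phi> w \<le> \<Phi> z"
      using minimizer_invariant[OF R(1) cover] by blast
    then show ?thesis by blast
  qed
  show ?thesis
  proof (intro conjI allI impI; elim conjE)
    fix f :: "real \<Rightarrow> real" and V :: "'v \<Rightarrow> real" and a q V0 Vinf :: real
    assume cont: "continuous_on UNIV f" and a: "a > 0" and q: "q > 2"
      and bound: "\<forall>u. \<bar>f u\<bar> \<le> a * (\<bar>u\<bar> + \<bar>u\<bar> powr (q - 1))"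
      and small: "f \<in> o[at 0](\<lambda>u. u)"
      and mono: "strict_mono_on {..<0} (\<lambda>u. f u / \<bar>u\<bar>)" "strict_mono_on {0<..} (\<lambda>u. f u / \<bar>u\<bar>)"
      and super: "filterlim (\<lambda>u. primitive f u / u\<^sup>2) at_top at_infinity"
      and V0: "0 < V0" and below: "bdd_below (range V)" "V0 \<le> (INF x. V x)"
      and above: "bdd_above (range V)" "(SUP x. V x) = Vinf"
      and lim: "(V \<longlongrightarrow> Vinf) cofinite"
    have V_ge: "V0 \<le> V x" for x using below cINF_lower[OF below(1), of x] by simp
    have V_le: "V x \<le> Vinf" for x using above cSUP_upper[OF _ above(1), of x] by simp
    have nl: "nonlinearity (\<lambda>_ :: 'v. f)"
    proof (rule nonlinearityI[OF cont a q])
      show "\<bar>f u\<bar> \<le> a * (\<bar>u\<bar> + \<bar>u\<bar> powr (q - 1))" for u using bound by blast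
      show "\<forall>\<^sub>F u in at 0. \<forall>x :: 'v. \<bar>f u\<bar> \<le> e * \<bar>u\<bar>" if "e > 0" for e
        using landau_o.smallD[OF small that] by simp
      show "\<forall>\<^sub>F u in at_infinity. \<forall>x :: 'v. primitive f u / u\<^sup>2 \<ge> C" for C
        using super by (simp add: filterlim_at_top)
    qed (rule mono)+
    have A: "nehari adj D V V0 Vinf (\<lambda>_. f)"
      by (intro nehari.intro nl schroedinger.intro schroedinger_axioms.intro bounded_degree_graph_axioms V0 V_ge V_le)
    have I: "nehari adj D (\<lambda>_. Vinf) V0 Vinf (\<lambda>_. f)"
      by (intro nehari.intro nl schroedinger.intro schroedinger_axioms.intro bounded_degree_graph_axioms V0 order_refl)
        (rule order_trans[OF V_ge V_le])
    obtain w where "w \<in> nehari.N adj (\<lambda>_. Vinf) (\<lambda>_. f)"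
      "\<And>z. z \<in> nehari.N adj (\<lambda>_. Vinf) (\<lambda>_. f) \<Longrightarrow> energy adj (\<lambda>_. Vinf) (\<lambda>_. f) w \<le> energy adj (\<lambda>_. Vinf) (\<lambda>_. f) z"
      using minimizer[OF I] by auto
    then obtain u where "u \<in> nehari.N adj V (\<lambda>_. f)"
      "\<And>z. z \<in> nehari.N adj V (\<lambda>_. f) \<Longrightarrow> energy adj V (\<lambda>_. f) u \<le> energy adj V (\<lambda>_. f) z"
      using minimizer_below_infinity[OF A I lim] by metis
    then show "\<exists>u. ground_state adj V (\<lambda>_. f) u"
      using nehari.minimizer_ground_state[OF A] by blast
  next
    fix f :: "'v \<Rightarrow> real \<Rightarrow> real" and V :: "'v \<Rightarrow> real" and a q :: real
    assume cont: "\<forall>x. continuous_on UNIV (f x)" and a: "a > 0" and q: "q > 2"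
      and bound: "\<forall>x u. \<bar>f x u\<bar> \<le> a * (\<bar>u\<bar> + \<bar>u\<bar> powr (q - 1))"
      and Vinv: "\<forall>g\<in>\<Gamma>. \<forall>x. V (g x) = V x" and finv: "\<forall>g\<in>\<Gamma>. \<forall>x u. f (g x) u = f x u"
      and Vpos: "\<forall>x. V x > 0"
      and small: "uniform_limit UNIV (\<lambda>u x. f x u / u) (\<lambda>x. 0) (at 0)"
      and mono: "\<forall>x. strict_mono_on {..<0} (\<lambda>u. f x u / \<bar>u\<bar>)" "\<forall>x. strict_mono_on {0<..} (\<lambda>u. f x u / \<bar>u\<bar>)"
      and super: "\<forall>C. \<forall>\<^sub>F u in at_infinity. \<forall>x. primitive (f x) u / u\<^sup>2 \<ge> C"
    have V_rep: "\<exists>y\<in>R. V x = V y" for x using orbit_const[of V] Vinv by blast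
    have "R \<noteq> {}" using R(2) by blast
    then have V0: "0 < Min (V ` R)" using R(1) Vpos by simp
    have V_ge: "Min (V ` R) \<le> V x" and V_le: "V x \<le> Max (V ` R)" for x
      using V_rep[of x] R(1) by auto
    have nl: "nonlinearity f"
    proof (rule nonlinearityI[OF _ a q])
      have "\<forall>\<^sub>F u in at (0 :: real). u \<noteq> 0" by (simp add: eventually_at_filter)
      then show "\<forall>\<^sub>F u in at 0. \<forall>x. \<bar>f x u\<bar> \<le> e * \<bar>u\<bar>" if "e > 0" for e
        using uniform_limitD[OF small that]
      proof eventually_elim
        case (elim u)
        show ?case
        proof
          fix x
          have "\<bar>f x u\<bar> / \<bar>u\<bar> < e" using elim by (simp add: dist_real_def)
          then show "\<bar>f x u\<bar> \<le> e * \<bar>u\<bar>" using elim(1) by (simp add: divide_less_eq)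
        qed
      qed
    qed (use cont bound mono super in blast)+
    have A: "nehari adj D V (Min (V ` R)) (Max (V ` R)) f"
      by (intro nehari.intro nl schroedinger.intro schroedinger_axioms.intro bounded_degree_graph_axioms V0 V_ge V_le)
    obtain u where "u \<in> nehari.N adj V f"
      "\<And>z. z \<in> nehari.N adj V f \<Longrightarrow> energy adj V f u \<le> energy adj V f z"
    proof -
      have "f (g x) = f x" if "g \<in> \<Gamma>" for g x using finv that by (intro ext) blast
      then show thesis using minimizer[OF A] Vinv that by blast
    qed
    then show "\<exists>u. ground_state adj V f u"
      using nehari.minimizer_ground_state[OF A] by blast
  qed
qed

end
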